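(* For a positive real number $\beta$, let $\mathcal{M}_\beta$ be the linear subspace of $L^\infty(\mathbb{R})$ spanned by the functions $x\mapsto e^{i m\pi x}$ and $x\mapsto e^{i n\pi\beta/x}$, where $m,n$ range over the integers. If $\beta>1$, then the weak-star closure of $\mathcal{M}_\beta$ in $L^\infty(\mathbb{R})$ has infinite codimension in $L^\infty(\mathbb{R})$.
   Context: $L^\infty(\mathbb{R})$ is the space of (classes of) essentially bounded complex-valued functions on $\mathbb{R}$ with respect to Lebesgue measure; the weak-star topology is the one it carries as the dual of $L^1(\mathbb{R})$ under the bilinear pairing $\langle f,g\rangle=\int_{\mathbb{R}}fg\,dx$. The span consists of finite complex linear combinations. *)

theory Defs
  imports "HOL-Analysis.Analysis"
begin

section \<open>The space of classes of essentially bounded functions\<close>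

definition ess_bounded :: "(real \<Rightarrow> complex) \<Rightarrow> bool" where
  "ess_bounded f \<longleftrightarrow>
     f \<in> borel_measurable lebesgue \<and> (\<exists>C. AE x in lebesgue. norm (f x) \<le> C)"

definition linf_rel :: "(real \<Rightarrow> complex) \<Rightarrow> (real \<Rightarrow> complex) \<Rightarrow> bool" where
  "linf_rel f g \<longleftrightarrow> ess_bounded f \<and> ess_bounded g \<and> (AE x in lebesgue. f x = g x)"

lemma linf_rel_eqI: "ess_bounded g \<Longrightarrow> (\<And>x. f x = g x) \<Longrightarrow> linf_rel f g"
  by (simp add: linf_rel_def ext[of f g])

lemma ess_bounded_bounded:
  assumes "f \<in> borel_measurable borel" "\<And>x. norm (f x) \<le> C"
  shows "ess_bounded f"
proof -
  have "f \<in> borel_measurable lebesgue"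
    using assms(1) by (intro measurable_completion) simp
  then show ?thesis
    unfolding ess_bounded_def using assms(2) by auto
qed

lemma ess_bounded_0: "ess_bounded (\<lambda>x. 0)"
  by (rule ess_bounded_bounded[where C = 0]) auto

lemma ess_bounded_add:
  assumes "ess_bounded f" "ess_bounded g"
  shows "ess_bounded (\<lambda>x. f x + g x)"
proof -
  obtain C D where C: "AE x in lebesgue. norm (f x) \<le> C" and D: "AE x in lebesgue. norm (g x) \<le> D"
    using assms unfolding ess_bounded_def by blast
  have "AE x in lebesgue. norm (f x + g x) \<le> C + D"
    using C D by eventually_elim (rule norm_triangle_mono)
  moreover have "(\<lambda>x. f x + g x) \<in> borel_measurable lebesgue"
    using assms unfolding ess_bounded_def by (intro borel_measurable_add) auto
  ultimately show ?thesis
    unfolding ess_bounded_def by blast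
qed

lemma ess_bounded_scale:
  assumes "ess_bounded f"
  shows "ess_bounded (\<lambda>x. c * f x)"
proof -
  obtain C where C: "AE x in lebesgue. norm (f x) \<le> C"
    using assms unfolding ess_bounded_def by blast
  have "AE x in lebesgue. norm (c * f x) \<le> norm c * C"
    using C by eventually_elim (simp add: norm_mult mult_left_mono)
  moreover have "(\<lambda>x. c * f x) \<in> borel_measurable lebesgue"
    using assms unfolding ess_bounded_def by (intro borel_measurable_times) auto
  ultimately show ?thesis
    unfolding ess_bounded_def by blast
qed

lemma ess_bounded_minus: "ess_bounded f \<Longrightarrow> ess_bounded (\<lambda>x. - f x)"
  using ess_bounded_scale[of f "-1"] by simp

lemma ess_bounded_diff:
  "ess_bounded f \<Longrightarrow> ess_bounded g \<Longrightarrow> ess_bounded (\<lambda>x. f x - g x)"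
  using ess_bounded_add[of f "\<lambda>x. - g x"] ess_bounded_minus[of g] by simp

quotient_type linf = "real \<Rightarrow> complex" / partial: linf_rel
proof (rule part_equivpI)
  show "\<exists>f. linf_rel f f"
    using ess_bounded_0 unfolding linf_rel_def by auto
  show "symp linf_rel"
    unfolding linf_rel_def by (rule sympI) (auto simp: eq_commute)
  show "transp linf_rel"
    unfolding linf_rel_def by (rule transpI) auto
qed

instantiation linf :: ab_group_add
begin

lift_definition zero_linf :: linf is "\<lambda>x. 0"
  by (simp add: linf_rel_def ess_bounded_0)

lift_definition plus_linf :: "linf \<Rightarrow> linf \<Rightarrow> linf" is "\<lambda>f g x. f x + g x"
  by (auto simp: linf_rel_def ess_bounded_add)

lift_definition minus_linf :: "linf \<Rightarrow> linf \<Rightarrow> linf" is "\<lambda>f g x. f x - g x"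
  by (auto simp: linf_rel_def ess_bounded_diff)

lift_definition uminus_linf :: "linf \<Rightarrow> linf" is "\<lambda>f x. - f x"
  by (auto simp: linf_rel_def ess_bounded_minus)

instance
proof
  fix a b c :: linf
  show "a + b + c = a + (b + c)"
    by transfer (rule linf_rel_eqI, auto simp: linf_rel_def add_ac intro!: ess_bounded_add)
  show "a + b = b + a"
    by transfer (rule linf_rel_eqI, auto simp: linf_rel_def add_ac intro!: ess_bounded_add)
  show "0 + a = a"
    by transfer (rule linf_rel_eqI, auto simp: linf_rel_def)
  show "- a + a = 0"
    by transfer (rule linf_rel_eqI, auto simp: linf_rel_def ess_bounded_0)
  show "a - b = a + - b"
    by transfer (rule linf_rel_eqI, auto simp: linf_rel_def intro!: ess_bounded_diff)
qed

end

lift_definition scale_linf :: "complex \<Rightarrow> linf \<Rightarrow> linf" is "\<lambda>c f x. c * f x"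
  by (auto simp: linf_rel_def ess_bounded_scale)

global_interpretation linf: vector_space scale_linf
proof
  fix a b :: complex and x y :: linf
  show "scale_linf a (x + y) = scale_linf a x + scale_linf a y"
    by transfer (rule linf_rel_eqI, auto simp: linf_rel_def algebra_simps
        intro!: ess_bounded_add ess_bounded_scale)
  show "scale_linf (a + b) x = scale_linf a x + scale_linf b x"
    by transfer (rule linf_rel_eqI, auto simp: linf_rel_def distrib_right
        intro!: ess_bounded_add ess_bounded_scale)
  show "scale_linf a (scale_linf b x) = scale_linf (a * b) x"
    by transfer (rule linf_rel_eqI, auto simp: linf_rel_def mult.assoc
        intro!: ess_bounded_scale)
  show "scale_linf 1 x = x"
    by transfer (rule linf_rel_eqI, auto simp: linf_rel_def)
qed

section \<open>The pairing with integrable functions and the weak-star topology\<close>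

lemma lebesgue_measurable_AE_cong:
  fixes f g :: "real \<Rightarrow> complex"
  assumes ae: "AE x in lebesgue. f x = g x" and f: "f \<in> borel_measurable lebesgue"
  shows "g \<in> borel_measurable lebesgue"
proof -
  obtain N where N: "N \<in> null_sets lebesgue" "{x \<in> space lebesgue. f x \<noteq> g x} \<subseteq> N"
    using ae by (elim AE_E) (blast intro: null_setsI)
  show ?thesis
  proof (rule measurableI)
    fix S :: "complex set" assume S: "S \<in> sets borel"
    have "g -` S \<inter> N \<in> sets lebesgue"
      using N(1) completion.complete2[of "g -` S \<inter> N" N lborel] by auto
    moreover have "f -` S - N \<in> sets lebesgue"
      using measurable_sets[OF f S] N(1) by auto
    moreover have "f x = g x" if "x \<notin> N" for x
      using N(2) that by auto
    then have "g -` S = (f -` S - N) \<union> (g -` S \<inter> N)"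
      by auto
    ultimately have "g -` S \<in> sets lebesgue"
      by (metis sets.Un)
    then show "g -` S \<inter> space lebesgue \<in> sets lebesgue"
      by simp
  qed auto
qed

lemma integral_lebesgue_AE_cong:
  fixes f g :: "real \<Rightarrow> complex"
  assumes "AE x in lebesgue. f x = g x"
  shows "integral\<^sup>L lebesgue f = integral\<^sup>L lebesgue g"
proof (cases "f \<in> borel_measurable lebesgue")
  case True
  then show ?thesis
    using assms lebesgue_measurable_AE_cong[OF assms] by (intro integral_cong_AE)
next
  case False
  have "AE x in lebesgue. g x = f x"
    using assms by auto
  then have "g \<notin> borel_measurable lebesgue"
    using False lebesgue_measurable_AE_cong by blast
  then show ?thesis
    using False by (metis borel_measurable_integrable not_integrable_integral_eq)
qed

lift_definition linf_pairing :: "linf \<Rightarrow> (real \<Rightarrow> complex) \<Rightarrow> complex" is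
  "\<lambda>f g. LINT x|lebesgue. f x * g x"
  by (rule ext, rule integral_lebesgue_AE_cong) (auto simp: linf_rel_def)

text \<open>The coarsest topology for which all functionals given by the pairing with an integrable
  function are continuous.\<close>

definition weak_star :: "linf topology" where
  "weak_star = topology_generated_by
     {{\<phi>. linf_pairing \<phi> g \<in> U} | g U. integrable lebesgue g \<and> open U}"

lemma topspace_weak_star [simp]: "topspace weak_star = UNIV"
proof -
  have "UNIV \<in> {{\<phi>. linf_pairing \<phi> g \<in> U} | g U. integrable lebesgue g \<and> open U}"
    by (intro CollectI exI[of _ "\<lambda>x. 0"] exI[of _ UNIV]) auto
  then show ?thesis
    unfolding weak_star_def topology_generated_by_topspace by blast
qed

section \<open>Codimension and the spaces of hyperbolic exponentials\<close>

text \<open>For a subspace \<open>W\<close>: the quotient by \<open>W\<close> is not spanned by the cosets of finitely many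
  vectors, i.e. it is not finite-dimensional.\<close>

definition (in vector_space) infinite_codimension :: "'b set \<Rightarrow> bool" where
  "infinite_codimension W \<longleftrightarrow> \<not> (\<exists>B. finite B \<and> span (W \<union> B) = UNIV)"

text \<open>The value at \<open>0\<close> of the second function is immaterial: \<open>{0}\<close> is a null set.\<close>

lift_definition exp_linf :: "int \<Rightarrow> linf" is
  "\<lambda>m x. exp (\<i> * of_int m * of_real pi * of_real x)"
  unfolding linf_rel_def
  by (auto intro!: ess_bounded_bounded[where C = 1])

lift_definition exp_inv_linf :: "real \<Rightarrow> int \<Rightarrow> linf" is
  "\<lambda>\<beta> n x. exp (\<i> * of_int n * of_real pi * of_real \<beta> / of_real x)"
  unfolding linf_rel_def
  by (auto intro!: ess_bounded_bounded[where C = 1])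

definition hyperbolic_span :: "real \<Rightarrow> linf set" where
  "hyperbolic_span \<beta> = linf.span (range exp_linf \<union> range (exp_inv_linf \<beta>))"

end

theory Submission
  imports Defs "HOL-Probability.Sinc_Integral" "HOL-Real_Asymp.Real_Asymp"
begin

text \<open>By duality it suffices to find infinitely many independent \<open>g \<in> L\<^sup>1\<close> annihilating all the
  exponentials. With \<open>J f(y) = f(\<beta>/y) \<beta>/y\<^sup>2\<close>, this means that both \<open>g\<close> and \<open>J g\<close> have vanishing
  \<open>2\<close>-periodization, so for \<open>g = G + J G\<close> there is the single condition \<open>per G + per (J G) = 0\<close>. Take
  \<open>G = \<chi> u + k\<close>, where \<open>k\<close> lives in the gap \<open>1 < x < \<surd>\<beta>\<close>, \<open>u\<close> is \<open>2\<close>-periodic, and \<open>\<chi>\<close> is a cutoff supported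
  slightly beyond \<open>[-1,1]\<close> whose translates by even integers sum to \<open>1\<close>. The condition becomes
  \<open>u - Q u = r\<close> with \<open>Q u = - per (J (\<chi> u))\<close> and \<open>r = - per (k + J k)\<close>. As \<open>x \<mapsto> \<beta>/x\<close> expands near \<open>[-1,1]\<close>,
  \<open>Q\<close> satisfies a Lasota-Yorke inequality
  \<open>\<parallel>(Q u)'\<parallel>\<^sub>1 \<le> \<theta> \<parallel>u'\<parallel>\<^sub>1 + C \<parallel>u\<parallel>\<^sub>1\<close> with \<open>\<theta> < 1\<close>, while \<open>\<parallel>Q u\<parallel>\<^sub>1 \<le> \<parallel>u\<parallel>\<^sub>1\<close>. If \<open>E\<close> interpolates on
  a fine grid, \<open>Q\<^sup>n (1 - E)\<close> is therefore a contraction, and a Neumann series solves \<open>u - Q u = r\<close> up to an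
  error in the fixed finite-dimensional range of \<open>Q\<^sup>n E\<close>. Letting \<open>k\<close> vary over many disjoint bumps, linear
  algebra removes this error and makes \<open>g\<close> orthogonal to any prescribed finite set as well.\<close>

section \<open>Periodization\<close>

text \<open>The sum of \<open>F (y + 2 * j)\<close> over all integers \<open>j\<close>; the index \<open>n\<close> collects \<open>j = n\<close> and \<open>j = - n - 1\<close>.\<close>

definition per :: "(real \<Rightarrow> real) \<Rightarrow> real \<Rightarrow> real" where
  "per F y = (\<Sum>n. F (y + 2 * real n) + F (y - 2 * real n - 2))"

text \<open>Quadratic decay is what the inversion gives: the image of a bounded function of bounded
  support falls off like 1/y^2. It is also enough for the sum over translates to converge uniformly
  on bounded sets.\<close>

definition decays :: "(real \<Rightarrow> real) \<Rightarrow> real \<Rightarrow> bool" where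
  "decays F K \<longleftrightarrow> (\<forall>y. \<bar>F y\<bar> \<le> K / (1 + y\<^sup>2))"

definition periodic2 :: "(real \<Rightarrow> real) \<Rightarrow> bool" where
  "periodic2 f \<longleftrightarrow> (\<forall>x. f (x + 2) = f x)"

definition decay_sum :: real where
  "decay_sum = (\<Sum>n. 1 / (1 + (real n)\<^sup>2))"

lemma summable_decay: "summable (\<lambda>n. 1 / (1 + (real n)\<^sup>2))"
proof (rule summable_comparison_test')
  show "summable (\<lambda>n. inverse ((real n)\<^sup>2))"
    by (rule inverse_power_summable) simp
  show "norm (1 / (1 + (real n)\<^sup>2)) \<le> inverse ((real n)\<^sup>2)" if "n \<ge> 1" for n
    using that by (simp add: divide_simps not_less)
qed

lemma decays_nonneg: "decays F K \<Longrightarrow> 0 \<le> K"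
  unfolding decays_def by (drule spec[of _ 0]) simp

text \<open>From 2n <= |t| + |y| and (s + r)^2 <= 2 s^2 + 2 r^2. Both translates in the n-th term of
  \<open>per\<close>, namely t = y + 2n and t = y - 2n - 2, satisfy the hypothesis on t.\<close>

lemma decay_shift_bound:
  fixes y R t n :: real
  assumes "\<bar>y\<bar> \<le> R" "\<bar>t\<bar> \<ge> 2 * n - \<bar>y\<bar>" "n \<ge> 0"
  shows "1 / (1 + t\<^sup>2) \<le> (1 + R\<^sup>2) / (1 + n\<^sup>2)"
proof -
  have y2: "y\<^sup>2 \<le> R\<^sup>2"
    using assms(1) by (metis abs_ge_zero order_trans power2_abs power_mono)
  have "(2 * n)\<^sup>2 \<le> (\<bar>t\<bar> + \<bar>y\<bar>)\<^sup>2"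
    using assms by (intro power_mono) auto
  also have "\<dots> \<le> 2 * t\<^sup>2 + 2 * y\<^sup>2"
    using zero_le_power2[of "\<bar>t\<bar> - \<bar>y\<bar>"] by (simp add: power2_sum power2_diff)
  finally have "4 * n\<^sup>2 \<le> 2 * t\<^sup>2 + 2 * R\<^sup>2"
    using y2 by (simp add: power_mult_distrib)
  then have "1 + n\<^sup>2 \<le> 1 + t\<^sup>2 + R\<^sup>2"
    using zero_le_power2[of t] zero_le_power2[of R] by linarith
  also have "\<dots> \<le> (1 + R\<^sup>2) * (1 + t\<^sup>2)"
    by (simp add: algebra_simps)
  finally show ?thesis
    by (simp add: divide_simps add_pos_nonneg)
qed

lemma per_term_bound:
  assumes "decays F K" "\<bar>y\<bar> \<le> R"
  shows "\<bar>F (y + 2 * real n) + F (y - 2 * real n - 2)\<bar> \<le> 2 * K * (1 + R\<^sup>2) * (1 / (1 + (real n)\<^sup>2))"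
proof -
  have *: "\<bar>F t\<bar> \<le> K * ((1 + R\<^sup>2) / (1 + (real n)\<^sup>2))" if "\<bar>t\<bar> \<ge> 2 * real n - \<bar>y\<bar>" for t
  proof -
    have "\<bar>F t\<bar> \<le> K * (1 / (1 + t\<^sup>2))"
      using assms(1) by (simp add: decays_def)
    also have "\<dots> \<le> K * ((1 + R\<^sup>2) / (1 + (real n)\<^sup>2))"
      using decay_shift_bound[OF assms(2) that] decays_nonneg[OF assms(1)]
      by (intro mult_left_mono) auto
    finally show ?thesis .
  qed
  have "\<bar>F (y + 2 * real n)\<bar> \<le> K * ((1 + R\<^sup>2) / (1 + (real n)\<^sup>2))"
    by (rule *) linarith
  moreover have "\<bar>F (y - 2 * real n - 2)\<bar> \<le> K * ((1 + R\<^sup>2) / (1 + (real n)\<^sup>2))"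
    by (rule *) linarith
  moreover have "2 * K * (1 + R\<^sup>2) * (1 / (1 + (real n)\<^sup>2)) = 2 * (K * ((1 + R\<^sup>2) / (1 + (real n)\<^sup>2)))"
    by simp
  ultimately show ?thesis
    by linarith
qed

lemma per_summable:
  assumes "decays F K"
  shows "summable (\<lambda>n. F (y + 2 * real n) + F (y - 2 * real n - 2))"
  by (rule summable_comparison_test'[where N = 0, OF summable_mult[OF summable_decay]])
     (use per_term_bound[OF assms, of y "\<bar>y\<bar>"] in auto)

lemma per_uniform_limit:
  assumes "decays F K"
  shows "uniform_limit {-R..R} (\<lambda>N y. \<Sum>n<N. F (y + 2 * real n) + F (y - 2 * real n - 2)) (per F) sequentially"
  unfolding per_def [abs_def]
  by (rule Weierstrass_m_test[OF _ summable_mult[OF summable_decay, of "2 * K * (1 + R\<^sup>2)"]])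
     (use per_term_bound[OF assms, of _ R] in auto)

lemma per_continuous:
  assumes F: "decays F K" "continuous_on UNIV F"
  shows "continuous_on UNIV (per F)"
proof -
  have c: "continuous_on {-R..R} (per F)" for R
    by (rule uniform_limit_theorem[OF _ per_uniform_limit[OF F(1)]])
       (auto intro!: always_eventually continuous_intros continuous_on_compose2[OF F(2)])
  have "isCont (per F) y" for y
    by (rule continuous_on_interior[OF c[of "\<bar>y\<bar> + 1"]]) auto
  then show ?thesis
    by (simp add: continuous_on_eq_continuous_at)
qed

text \<open>Termwise differentiation: the decay of \<open>F'\<close> makes the series of derivatives
  converge uniformly near y, and the decay of \<open>F\<close> makes the series itself
  converge.\<close>

lemma per_deriv:
  assumes F: "decays F K" and F': "decays F' K'"
    and der: "\<And>y. (F has_real_derivative F' y) (at y)"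
  shows "(per F has_real_derivative per F' y) (at y)"
proof -
  define R where "R = \<bar>y\<bar> + 1"
  have uc: "uniformly_convergent_on {-R..R}
      (\<lambda>N y. \<Sum>n<N. F' (y + 2 * real n) + F' (y - 2 * real n - 2))"
    using per_uniform_limit[OF F', of R] by (auto simp: uniformly_convergent_on_def)
  show ?thesis
    unfolding per_def [abs_def]
  proof (rule has_field_derivative_series'(2)[OF _ _ uc])
    fix n x
    have "((\<lambda>y. F (y + 2 * real n) + F (y - 2 * real n - 2)) has_real_derivative
        F' (x + 2 * real n) + F' (x - 2 * real n - 2)) (at x)"
      by (auto intro!: derivative_eq_intros DERIV_chain2[OF der])
    then show "((\<lambda>y. F (y + 2 * real n) + F (y - 2 * real n - 2)) has_real_derivative
        F' (x + 2 * real n) + F' (x - 2 * real n - 2)) (at x within {-R..R})"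
      by (rule has_field_derivative_at_within)
    show "y \<in> {-R..R}" "y \<in> interior {-R..R}"
      by (auto simp: R_def)
    show "summable (\<lambda>n. F (y + 2 * real n) + F (y - 2 * real n - 2))"
      by (rule per_summable[OF F])
  qed auto
qed

lemma decays_tendsto:
  assumes "decays F K" "filterlim g at_infinity sequentially"
  shows "(\<lambda>n. F (g n)) \<longlonglongrightarrow> 0"
proof (rule Lim_null_comparison)
  show "\<forall>\<^sub>F n in sequentially. norm (F (g n)) \<le> K * inverse (1 + (g n)\<^sup>2)"
    using assms(1) by (simp add: decays_def divide_inverse)
  have "filterlim (\<lambda>n. (g n)\<^sup>2) at_top sequentially"
    using filterlim_pow_at_top[OF _ filterlim_at_infinity_imp_norm_at_top[OF assms(2)], of 2] by simp
  then have "filterlim (\<lambda>n. 1 + (g n)\<^sup>2) at_top sequentially"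
    by (rule filterlim_tendsto_add_at_top[OF tendsto_const])
  then have "(\<lambda>n. inverse (1 + (g n)\<^sup>2)) \<longlonglongrightarrow> 0"
    by (rule tendsto_inverse_0_at_top)
  then show "(\<lambda>n. K * inverse (1 + (g n)\<^sup>2)) \<longlonglongrightarrow> 0"
    by (rule tendsto_mult_right_zero)
qed

lemma per_sums: "decays F K \<Longrightarrow> (\<lambda>N. \<Sum>n<N. F (y + 2 * real n) + F (y - 2 * real n - 2)) \<longlonglongrightarrow> per F y"
  using summable_LIMSEQ[OF per_summable] unfolding per_def .

text \<open>Shifting y by 2 changes the N-th partial sum only by the boundary terms F(y + 2N) - F(y
  - 2N), which vanish in the limit by decay.\<close>

lemma per_periodic2:
  assumes "decays F K"
  shows "periodic2 (per F)"
  unfolding periodic2_def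
proof
  fix y
  have tele: "(\<Sum>n<N. F (y + 2 + 2 * real n) + F (y + 2 - 2 * real n - 2))
      = (\<Sum>n<N. F (y + 2 * real n) + F (y - 2 * real n - 2))
        + (F (y + 2 * real N) - F (y - 2 * real N))" for N
    by (induction N) (simp_all add: algebra_simps)
  have "filterlim (\<lambda>N. y + 2 * real N) at_infinity sequentially"
    by (intro filterlim_at_top_imp_at_infinity) real_asymp
  moreover have "filterlim (\<lambda>N. y - 2 * real N) at_infinity sequentially"
    by (intro filterlim_at_bot_imp_at_infinity) real_asymp
  ultimately have "(\<lambda>N. (\<Sum>n<N. F (y + 2 * real n) + F (y - 2 * real n - 2))
        + (F (y + 2 * real N) - F (y - 2 * real N))) \<longlonglongrightarrow> per F y + (0 - 0)"
    by (intro tendsto_add tendsto_diff per_sums[OF assms] decays_tendsto[OF assms])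
  then show "per F (y + 2) = per F y"
    using LIMSEQ_unique[OF per_sums[OF assms, of "y + 2"]] unfolding tele by simp
qed

lemma per_add: "decays F K \<Longrightarrow> decays G K' \<Longrightarrow> per (\<lambda>x. F x + G x) y = per F y + per G y"
  unfolding per_def
  by (subst suminf_add[OF per_summable per_summable]) (auto simp: algebra_simps)

lemma per_cmult: "decays F K \<Longrightarrow> per (\<lambda>x. c * F x) y = c * per F y"
  unfolding per_def
  by (subst suminf_mult[OF per_summable, symmetric]) (auto simp: algebra_simps)

lemma decays_add: "decays F K \<Longrightarrow> decays G K' \<Longrightarrow> decays (\<lambda>x. F x + G x) (K + K')"
  unfolding decays_def by (auto simp: add_divide_distrib intro: order_trans[OF abs_triangle_ineq] add_mono)

lemma decays_mult_bounded:
  assumes "decays F K" "\<And>x. \<bar>p x\<bar> \<le> B"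
  shows "decays (\<lambda>x. F x * p x) (K * B)"
  unfolding decays_def
proof
  fix y
  have "\<bar>F y * p y\<bar> \<le> K / (1 + y\<^sup>2) * B"
    unfolding abs_mult using assms decays_nonneg[OF assms(1)]
    by (intro mult_mono) (auto simp: decays_def)
  then show "\<bar>F y * p y\<bar> \<le> K * B / (1 + y\<^sup>2)" by simp
qed

lemma periodic2_shift_nat:
  assumes "periodic2 f"
  shows "f (x + 2 * real n) = f x" "f (x - 2 * real n) = f x"
proof -
  show *: "f (x + 2 * real n) = f x" for x
  proof (induction n)
    case (Suc n)
    then show ?case
      using assms[unfolded periodic2_def, rule_format, of "x + 2 * real n"] by (simp add: algebra_simps)
  qed simp
  show "f (x - 2 * real n) = f x"
    using *[of "x - 2 * real n"] by simp
qed

text \<open>The representative y is chosen before f, so one reduction serves several periodic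
  functions at once.\<close>

lemma periodic2_reduce:
  fixes x :: real
  obtains y where "0 \<le> y" "y < 2" "\<And>f. periodic2 f \<Longrightarrow> f x = f y"
proof -
  define k where "k = \<lfloor>x / 2\<rfloor>"
  have k: "of_int k \<le> x / 2" "x / 2 < of_int k + 1"
    unfolding k_def by linarith+
  have "f x = f (x - 2 * of_int k)" if "periodic2 f" for f :: "real \<Rightarrow> real"
  proof (cases "k \<ge> 0")
    case True
    then show ?thesis
      using periodic2_shift_nat(2)[OF that, of x "nat k"] by simp
  next
    case False
    then show ?thesis
      using periodic2_shift_nat(1)[OF that, of x "nat (- k)"] by simp
  qed
  moreover have "0 \<le> x - 2 * of_int k" "x - 2 * of_int k < 2"
    using k by linarith+
  ultimately show ?thesis
    using that by blast
qed

text \<open>By periodicity y may be taken in [0, 2); the termwise bound with R = 2 then has the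
  factor 2 * (1 + 2^2) = 10.\<close>

lemma per_bound:
  assumes "decays F K"
  shows "\<bar>per F x\<bar> \<le> 10 * decay_sum * K"
proof -
  obtain y where y: "0 \<le> y" "y < 2" "per F x = per F y"
    using periodic2_reduce[of x] per_periodic2[OF assms] by metis
  have "\<bar>per F y\<bar> \<le> (\<Sum>n. 2 * K * (1 + 2\<^sup>2) * (1 / (1 + (real n)\<^sup>2)))"
    unfolding per_def real_norm_def[symmetric]
    by (rule norm_suminf_le[OF _ summable_mult[OF summable_decay]])
       (use per_term_bound[OF assms, of y 2] y in auto)
  also have "\<dots> = 10 * decay_sum * K"
    by (subst suminf_mult[OF summable_decay]) (simp add: decay_sum_def)
  finally show ?thesis using y by simp
qed

lemma per_mult_periodic2:
  assumes "periodic2 p" and F: "decays F K"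
  shows "per (\<lambda>x. F x * p x) y = per F y * p y"
proof -
  have "p (y - 2 * real n - 2) = p y" for n
    using periodic2_shift_nat(2)[OF assms(1), of y "Suc n"] by (simp add: algebra_simps)
  then have "per (\<lambda>x. F x * p x) y = (\<Sum>n. (F (y + 2 * real n) + F (y - 2 * real n - 2)) * p y)"
    unfolding per_def by (simp only: periodic2_shift_nat(1)[OF assms(1)] distrib_right)
  then show ?thesis
    unfolding per_def by (simp add: suminf_mult2[OF per_summable[OF F]])
qed

lemma decays_absolutely_integrable:
  assumes "decays F K" "continuous_on UNIV F"
  shows "F absolutely_integrable_on UNIV"
proof -
  have "integrable lborel (\<lambda>x::real. inverse (1 + x\<^sup>2))"
    using integrable_inverse_1_plus_square by (simp add: set_integrable_def)
  then have "integrable lborel (\<lambda>x. K * inverse (1 + x\<^sup>2))"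
    by (rule integrable_mult_right)
  then have "integrable lborel F"
  proof (rule Bochner_Integration.integrable_bound)
    show "F \<in> borel_measurable lborel"
      using assms(2) by (simp add: borel_measurable_continuous_onI)
    show "AE x in lborel. norm (F x) \<le> norm (K * inverse (1 + x\<^sup>2))"
      using assms(1) decays_nonneg[OF assms(1)] by (auto simp: decays_def divide_inverse abs_mult)
  qed
  then show ?thesis
    by (simp add: set_integrable_def integrable_completion)
qed

text \<open>Unfolding: the N-th partial sum integrates over [0, 2] to the integral of F over
  [-2N, 2N]. Uniform convergence gives the limit of the former, dominated convergence that of the
  latter.\<close>

lemma per_integral:
  assumes F: "decays F K" "continuous_on UNIV F"
  shows "integral {0..2} (per F) = integral UNIV F"
proof -
  have int: "F integrable_on {a..b}" for a b
    by (rule integrable_continuous_real[OF continuous_on_subset[OF F(2)]]) auto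
  have int': "(\<lambda>x. F (x + c)) integrable_on {a..b}" for a b c
    by (rule integrable_continuous_real) (auto intro!: continuous_intros continuous_on_compose2[OF F(2)])
  have shift: "integral {0..2} (\<lambda>x. F (x + c)) = integral {c..c + 2} F" for c
    using integral_shift_real_ivl[of c c "c + 2" F] by simp
  have part: "integral {0..2} (\<lambda>y. \<Sum>n<N. F (y + 2 * real n) + F (y - 2 * real n - 2))
      = integral {- 2 * real N..2 * real N} F" for N
  proof (induction N)
    case (Suc N)
    have a: "(\<lambda>y. \<Sum>n<N. F (y + 2 * real n) + F (y - 2 * real n - 2)) integrable_on {0..2}"
      by (rule integrable_continuous_real) (auto intro!: continuous_intros continuous_on_compose2[OF F(2)])
    have b: "(\<lambda>y. F (y - 2 * real N - 2)) integrable_on {0..2}"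
      using int'[of "- 2 * real N - 2"] by (simp add: algebra_simps)
    have "integral {0..2} (\<lambda>y. \<Sum>n<Suc N. F (y + 2 * real n) + F (y - 2 * real n - 2))
       = integral {- 2 * real N..2 * real N} F +
         (integral {0..2} (\<lambda>y. F (y + 2 * real N)) + integral {0..2} (\<lambda>y. F (y - 2 * real N - 2)))"
      using Suc by (simp add: Henstock_Kurzweil_Integration.integral_add[OF a integrable_add[OF int' b]]
          Henstock_Kurzweil_Integration.integral_add[OF int' b])
    also have "integral {0..2} (\<lambda>y. F (y - 2 * real N - 2)) = integral {- 2 * real (Suc N)..- 2 * real N} F"
    proof -
      have "(\<lambda>y. F (y - 2 * real N - 2)) = (\<lambda>y. F (y + (- 2 * real (Suc N))))"
        by (simp add: algebra_simps)
      moreover have "- 2 * real (Suc N) + 2 = - 2 * real N" by simp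
      ultimately show ?thesis
        using shift[of "- 2 * real (Suc N)"] by presburger
    qed
    also have "integral {0..2} (\<lambda>y. F (y + 2 * real N)) = integral {2 * real N..2 * real (Suc N)} F"
      using shift[of "2 * real N"] by (simp add: algebra_simps)
    also have "integral {- 2 * real N..2 * real N} F +
        (integral {2 * real N..2 * real (Suc N)} F + integral {- 2 * real (Suc N)..- 2 * real N} F)
        = integral {- 2 * real (Suc N)..2 * real (Suc N)} F"
      using Henstock_Kurzweil_Integration.integral_combine[OF _ _ int,
          of "- 2 * real (Suc N)" "- 2 * real N" "2 * real (Suc N)"]
        Henstock_Kurzweil_Integration.integral_combine[OF _ _ int,
          of "- 2 * real N" "2 * real N" "2 * real (Suc N)"]
      by simp
    finally show ?case .
  qed simp
  have "uniform_limit {0..2} (\<lambda>N y. \<Sum>n<N. F (y + 2 * real n) + F (y - 2 * real n - 2)) (per F) sequentially"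
    by (rule uniform_limit_on_subset[OF per_uniform_limit[OF F(1), of 2]]) auto
  then obtain I J where IJ:
    "\<And>N. ((\<lambda>y. \<Sum>n<N. F (y + 2 * real n) + F (y - 2 * real n - 2)) has_integral I N) {0..2}"
    "(per F has_integral J) {0..2}" "I \<longlonglongrightarrow> J"
    by (rule uniform_limit_integral) (auto intro!: continuous_intros continuous_on_compose2[OF F(2)])
  then have "(\<lambda>N. integral {0..2} (\<lambda>y. \<Sum>n<N. F (y + 2 * real n) + F (y - 2 * real n - 2)))
      \<longlonglongrightarrow> integral {0..2} (per F)"
    by (simp add: integral_unique[OF IJ(1)] integral_unique[OF IJ(2)])
  moreover have "(\<lambda>N. integral {- 2 * real N..2 * real N} F) \<longlonglongrightarrow> integral UNIV F"
  proof -
    have "(\<lambda>N. integral UNIV (\<lambda>x. if x \<in> {- 2 * real N..2 * real N} then F x else 0)) \<longlonglongrightarrow> integral UNIV F"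
    proof (rule dominated_convergence(2))
      show "(\<lambda>x. if x \<in> {- 2 * real N..2 * real N} then F x else 0) integrable_on UNIV" for N
        using int by (simp only: integrable_restrict_UNIV)
      show "(\<lambda>x. \<bar>F x\<bar>) integrable_on UNIV"
        using decays_absolutely_integrable[OF F]
        by (simp add: absolutely_integrable_on_def)
      show "(\<lambda>N. if x \<in> {- 2 * real N..2 * real N} then F x else 0) \<longlonglongrightarrow> F x" for x
      proof (rule tendsto_eventually)
        have "\<forall>\<^sub>F N in sequentially. \<bar>x\<bar> \<le> 2 * real N" by real_asymp
        then show "\<forall>\<^sub>F N in sequentially. (if x \<in> {- 2 * real N..2 * real N} then F x else 0) = F x"
          by eventually_elim auto
      qed
    qed auto
    then show ?thesis by (simp only: integral_restrict_UNIV)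
  qed
  ultimately show ?thesis
    unfolding part by (rule LIMSEQ_unique)
qed

lemma per_abs_integral:
  assumes F: "decays F K" "continuous_on UNIV F"
  shows "integral {0..2} (\<lambda>x. \<bar>per F x\<bar>) \<le> integral UNIV (\<lambda>x. \<bar>F x\<bar>)"
proof -
  have aF: "decays (\<lambda>x. \<bar>F x\<bar>) K" "continuous_on UNIV (\<lambda>x. \<bar>F x\<bar>)"
    using F by (auto simp: decays_def intro: continuous_intros)
  have "integral {0..2} (\<lambda>x. \<bar>per F x\<bar>) \<le> integral {0..2} (per (\<lambda>x. \<bar>F x\<bar>))"
  proof (rule integral_le)
    show "(\<lambda>x. \<bar>per F x\<bar>) integrable_on {0..2}" "per (\<lambda>x. \<bar>F x\<bar>) integrable_on {0..2}"
      using per_continuous[OF F] per_continuous[OF aF]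
      by (auto intro!: integrable_continuous_real continuous_intros intro: continuous_on_subset)
    show "\<bar>per F x\<bar> \<le> per (\<lambda>x. \<bar>F x\<bar>) x" for x
      unfolding per_def[of "\<lambda>x. \<bar>F x\<bar>"] unfolding per_def real_norm_def[symmetric]
      by (rule norm_suminf_le[OF _ per_summable[OF aF(1), unfolded real_norm_def[symmetric]]]) (rule norm_triangle_ineq)
  qed
  then show ?thesis by (simp add: per_integral[OF aF])
qed

section \<open>Smooth steps and the inversion\<close>

text \<open>A quadratic spline with knots 0, 1/2 and 1, written in truncated powers. It rises from 0
  to 1 and is once continuously differentiable, with a piecewise linear hat as derivative; no more
  smoothness is called for.\<close>

definition step :: "real \<Rightarrow> real" where
  "step t = 2 * ((max 0 t)\<^sup>2 - 2 * (max 0 (t - 1/2))\<^sup>2 + (max 0 (t - 1))\<^sup>2)"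

definition step' :: "real \<Rightarrow> real" where
  "step' t = 4 * (max 0 t - 2 * max 0 (t - 1/2) + max 0 (t - 1))"

lemma DERIV_max0_power2: "((\<lambda>t. (max 0 t)\<^sup>2) has_real_derivative 2 * max 0 t) (at t)"
proof -
  consider "t < 0" | "t > 0" | "t = 0" by linarith
  then show ?thesis
  proof cases
    case 1
    have "((\<lambda>t. 0) has_real_derivative 2 * max 0 t) (at t)"
      using 1 by simp
    then show ?thesis
      by (rule DERIV_cong_ev[THEN iffD1, rotated 3])
         (use 1 in \<open>auto intro: eventually_mono[OF order_tendstoD(2)[OF tendsto_ident_at]] eventually_nhds_in_open simp: eventually_nhds intro!: exI[of _ "{..<0}"]\<close>)
  next
    case 2
    have "((\<lambda>t. t\<^sup>2) has_real_derivative 2 * max 0 t) (at t)"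
      using 2 by (auto intro!: derivative_eq_intros)
    then show ?thesis
      by (rule DERIV_cong_ev[THEN iffD1, rotated 3])
         (use 2 in \<open>auto simp: eventually_nhds max_def intro!: exI[of _ "{0<..}"]\<close>)
  next
    case 3
    have "(\<lambda>h::real. (max 0 h)\<^sup>2 / h) \<midarrow>0\<rightarrow> 0"
      by (rule Lim_null_comparison[where g = abs])
         (auto simp: max_def power2_eq_square intro!: tendsto_eq_intros always_eventually)
    with 3 show ?thesis
      by (simp add: DERIV_def)
  qed
qed

lemma step_deriv: "(step has_real_derivative step' t) (at t)"
proof -
  have d: "((\<lambda>t. (max 0 (t - a))\<^sup>2) has_real_derivative 2 * max 0 (t - a)) (at t)" for a
  proof -
    have "((\<lambda>t. t - a) has_real_derivative 1) (at t)"
      by (auto intro!: derivative_eq_intros)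
    from DERIV_chain2[OF DERIV_max0_power2 this] show ?thesis by simp
  qed
  show ?thesis
    unfolding step_def [abs_def] step'_def
    by (rule DERIV_cong[OF DERIV_cmult[OF DERIV_add[OF DERIV_diff[OF DERIV_max0_power2
        DERIV_cmult[OF d]] d]]]) simp
qed

lemma continuous_step' [continuous_intros]: "continuous_on S f \<Longrightarrow> continuous_on S (\<lambda>x. step' (f x))"
  unfolding step'_def by (intro continuous_intros)

lemma continuous_step [continuous_intros]: "continuous_on S f \<Longrightarrow> continuous_on S (\<lambda>x. step (f x))"
  unfolding step_def by (intro continuous_intros)

lemma step'_nonneg: "0 \<le> step' t"
  unfolding step'_def by (auto simp: max_def)

lemma step_mono: "s \<le> t \<Longrightarrow> step s \<le> step t"
  by (rule DERIV_nonneg_imp_nondecreasing) (use step_deriv step'_nonneg in blast)+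

lemma step_eq_0: "t \<le> 0 \<Longrightarrow> step t = 0" "t \<le> 0 \<Longrightarrow> step' t = 0"
  unfolding step_def step'_def by auto

lemma step_eq_1: "t \<ge> 1 \<Longrightarrow> step t = 1" "t \<ge> 1 \<Longrightarrow> step' t = 0"
  unfolding step_def step'_def by (auto simp: power2_eq_square algebra_simps)

lemma step_bounds: "0 \<le> step t" "step t \<le> 1"
  using step_mono[of 0 t] step_eq_0(1)[of t] step_eq_0(1)[of 0] step_mono[of t 1] step_eq_1(1)[of t] step_eq_1(1)[of 1]
  by (cases "t \<le> 0"; force)+

text \<open>The density of the image of \<open>f dx\<close> under \<open>x \<mapsto> \<beta> / x\<close>. Division by zero makes the value at \<open>0\<close> equal to \<open>0\<close>.\<close>

definition inv_push :: "real \<Rightarrow> (real \<Rightarrow> real) \<Rightarrow> real \<Rightarrow> real" where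
  "inv_push \<beta> f y = f (\<beta> / y) * \<beta> / y\<^sup>2"

text \<open>Change of variables on the line without 0, which the inversion maps bijectively onto
  itself; the point 0 is negligible.\<close>

lemma inv_push_integral:
  assumes \<beta>: "\<beta> > 0" and f: "f absolutely_integrable_on UNIV"
  shows "inv_push \<beta> f absolutely_integrable_on UNIV" "integral UNIV (inv_push \<beta> f) = integral UNIV f"
proof -
  have S: "- {0::real} \<in> sets lebesgue" by simp
  have der: "((\<lambda>y. \<beta> / y) has_real_derivative - \<beta> / y\<^sup>2) (at y within - {0})" if "y \<in> - {0}" for y
    using that by (auto intro!: derivative_eq_intros simp: power2_eq_square)
  have inj: "inj_on (\<lambda>y. \<beta> / y) (- {0})"
    using \<beta> by (auto simp: inj_on_def field_simps)
  have im: "(\<lambda>y. \<beta> / y) ` (- {0}) = - {0}"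
  proof
    show "- {0} \<subseteq> (\<lambda>y. \<beta> / y) ` (- {0})"
    proof
      fix x :: real assume "x \<in> - {0}"
      then show "x \<in> (\<lambda>y. \<beta> / y) ` (- {0})"
        using \<beta> by (intro image_eqI[of _ _ "\<beta> / x"]) auto
    qed
  qed (use \<beta> in auto)
  have eq: "(\<lambda>y. \<bar>- \<beta> / y\<^sup>2\<bar> * f (\<beta> / y)) = inv_push \<beta> f"
    using \<beta> by (auto simp: inv_push_def)
  have neg: "negligible {x \<in> UNIV - - {0::real}. g x \<noteq> 0}" "negligible {x \<in> - {0::real} - UNIV. g x \<noteq> 0}" for g :: "real \<Rightarrow> real"
    by (rule negligible_subset[of "{0}"]; auto)+
  have f': "f absolutely_integrable_on - {0}"
    using f by (rule absolutely_integrable_spike_set) (use neg[of f] in auto)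
  have "integral (- {0}) f = integral UNIV f" for f :: "real \<Rightarrow> real"
    by (rule integral_spike_set) (use neg[of f] in auto)
  moreover have "inv_push \<beta> f absolutely_integrable_on (- {0}) \<and> integral (- {0}) (inv_push \<beta> f) = integral (- {0}) f"
    using has_absolute_integral_change_of_variables_1'[OF S der inj, of f "integral (- {0}) f"] f'
    unfolding im eq by blast
  moreover have "inv_push \<beta> f absolutely_integrable_on UNIV" if "inv_push \<beta> f absolutely_integrable_on (- {0})"
    using that by (rule absolutely_integrable_spike_set) (use neg[of "inv_push \<beta> f"] in auto)
  ultimately show "inv_push \<beta> f absolutely_integrable_on UNIV" "integral UNIV (inv_push \<beta> f) = integral UNIV f"
    by auto
qed

text \<open>For functions supported in [-c, c] the image under the inversion vanishes near 0, so the
  singularity there does no harm. The locale is used with two radii: that of the cutoff, and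
  \<open>sqrt \<beta>\<close>.\<close>

locale support_bound =
  fixes \<beta> c :: real
  assumes \<beta>_pos: "\<beta> > 0" and c_pos: "c > 0"
begin

lemma inv_push_eq_0:
  assumes f: "\<And>x. \<bar>x\<bar> \<ge> c \<Longrightarrow> f x = 0" and y: "\<bar>y\<bar> \<le> \<beta> / c"
  shows "inv_push \<beta> f y = 0"
proof (cases "y = 0")
  case False
  then have "\<bar>\<beta> / y\<bar> \<ge> c"
    using y c_pos \<beta>_pos by (simp add: abs_divide field_simps)
  then show ?thesis
    by (simp add: inv_push_def f)
qed (simp add: inv_push_def)

text \<open>Where the image is nonzero, |y| > \<beta> / c and so \<beta> / y^2 < c^2 / \<beta>.
  Multiplying \<beta> / y^2 by 1 + y^2 therefore gives at most c^2 / \<beta> + \<beta>.\<close>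

lemma inv_push_decays:
  assumes f: "\<And>x. \<bar>x\<bar> \<ge> c \<Longrightarrow> f x = 0" and B: "\<And>x. \<bar>f x\<bar> \<le> B"
  shows "decays (inv_push \<beta> f) (B * (c\<^sup>2 / \<beta> + \<beta>))"
  unfolding decays_def
proof
  fix y
  have B0: "0 \<le> B" using B[of 0] by linarith
  show "\<bar>inv_push \<beta> f y\<bar> \<le> B * (c\<^sup>2 / \<beta> + \<beta>) / (1 + y\<^sup>2)"
  proof (cases "\<bar>y\<bar> \<le> \<beta> / c")
    case True
    then show ?thesis
      using inv_push_eq_0[OF f True] B0 \<beta>_pos by simp
  next
    case False
    then have y0: "y \<noteq> 0" and "\<beta> < \<bar>y\<bar> * c"
      using c_pos \<beta>_pos by (auto simp: field_simps)
    then have "\<beta>\<^sup>2 \<le> (\<bar>y\<bar> * c)\<^sup>2"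
      using \<beta>_pos by (intro power_mono) auto
    then have "\<beta>\<^sup>2 / (\<beta> * y\<^sup>2) \<le> (\<bar>y\<bar> * c)\<^sup>2 / (\<beta> * y\<^sup>2)"
      using \<beta>_pos by (intro divide_right_mono) auto
    then have "\<beta> / y\<^sup>2 \<le> c\<^sup>2 / \<beta>"
      using \<beta>_pos y0 by (simp add: power_mult_distrib) (simp add: power2_eq_square)
    then have "\<beta> / y\<^sup>2 * (1 + y\<^sup>2) \<le> c\<^sup>2 / \<beta> + \<beta>"
      using y0 by (simp add: field_simps)
    then have "\<beta> / y\<^sup>2 \<le> (c\<^sup>2 / \<beta> + \<beta>) / (1 + y\<^sup>2)"
      by (simp add: pos_le_divide_eq add_pos_nonneg)
    moreover have "\<bar>inv_push \<beta> f y\<bar> = \<bar>f (\<beta> / y)\<bar> * (\<beta> / y\<^sup>2)"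
      using \<beta>_pos by (simp add: inv_push_def abs_mult abs_divide)
    ultimately show ?thesis
      using B[of "\<beta> / y"] B0 \<beta>_pos
      by (metis mult_mono abs_ge_zero times_divide_eq_right divide_nonneg_nonneg less_imp_le zero_le_power2)
  qed
qed

lemma inv_push_continuous:
  assumes f: "\<And>x. \<bar>x\<bar> \<ge> c \<Longrightarrow> f x = 0" and cont: "continuous_on UNIV f"
  shows "continuous_on UNIV (inv_push \<beta> f)"
proof -
  have "continuous_on (- {0}) (inv_push \<beta> f)"
    unfolding inv_push_def [abs_def]
    by (auto intro!: continuous_intros continuous_on_compose2[OF cont])
  moreover have "continuous_on {- (\<beta> / c)<..<\<beta> / c} (inv_push \<beta> f)"
    by (subst continuous_on_cong[OF refl, where g = "\<lambda>_. 0"]) (auto intro!: inv_push_eq_0 f)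
  ultimately have "continuous_on (- {0} \<union> {- (\<beta> / c)<..<\<beta> / c}) (inv_push \<beta> f)"
    by (intro continuous_on_open_Un) auto
  moreover have "- {0} \<union> {- (\<beta> / c)<..<\<beta> / c} = UNIV"
    using \<beta>_pos c_pos by auto
  ultimately show ?thesis by simp
qed

text \<open>With x = \<beta> / y the image is x^2 f(x) / \<beta>, and dx/dy = - \<beta> / y^2. So
  its derivative is again, up to sign, an image: that of (x^2 f)' / \<beta>. The weight x^2 /
  \<beta> on f' is the source of the contraction of variation.\<close>

lemma inv_push_deriv:
  assumes f: "\<And>x. \<bar>x\<bar> \<ge> c \<Longrightarrow> f x = 0" and f': "\<And>x. \<bar>x\<bar> \<ge> c \<Longrightarrow> f' x = 0"
    and der: "\<And>x. (f has_real_derivative f' x) (at x)"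
  shows "(inv_push \<beta> f has_real_derivative - inv_push \<beta> (\<lambda>x. (2 * x * f x + x\<^sup>2 * f' x) / \<beta>) y) (at y)"
proof (cases "y = 0")
  case False
  then show ?thesis
    unfolding inv_push_def [abs_def] using \<beta>_pos
    by (auto intro!: derivative_eq_intros DERIV_chain2[OF der] simp: field_simps power2_eq_square)
next
  case True
  have ev: "eventually (\<lambda>y. 0 = inv_push \<beta> f y) (nhds 0)"
    unfolding eventually_nhds
    using \<beta>_pos c_pos inv_push_eq_0[OF f] by (intro exI[of _ "{- (\<beta> / c)<..<\<beta> / c}"]) force
  have "(inv_push \<beta> f has_real_derivative 0) (at 0)"
    by (rule DERIV_cong_ev[OF refl ev refl, THEN iffD1]) simp
  then show ?thesis
    using True by (simp add: inv_push_def)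
qed

end

lemma compact_support_decays:
  assumes f: "\<And>x. \<bar>x\<bar> \<ge> R \<Longrightarrow> f x = 0" and B: "\<And>x. \<bar>f x\<bar> \<le> B" and R: "R \<ge> 0"
  shows "decays f (B * (1 + R\<^sup>2))"
  unfolding decays_def
proof
  fix y
  have B0: "0 \<le> B" using B[of 0] by linarith
  show "\<bar>f y\<bar> \<le> B * (1 + R\<^sup>2) / (1 + y\<^sup>2)"
  proof (cases "\<bar>y\<bar> \<ge> R")
    case False
    then have "\<bar>y\<bar>\<^sup>2 \<le> R\<^sup>2" by (intro power_mono) auto
    then have "1 \<le> (1 + R\<^sup>2) / (1 + y\<^sup>2)" by (simp add: pos_le_divide_eq add_pos_nonneg)
    then have "B * 1 \<le> B * ((1 + R\<^sup>2) / (1 + y\<^sup>2))" using B0 by (rule mult_left_mono)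
    then show ?thesis using B[of y] by simp
  qed (use f B0 in simp)
qed

lemma compact_support_bounded:
  fixes f :: "real \<Rightarrow> real"
  assumes f: "\<And>x. \<bar>x\<bar> \<ge> R \<Longrightarrow> f x = 0" and cont: "continuous_on UNIV f"
  obtains B where "B \<ge> 0" "\<And>x. \<bar>f x\<bar> \<le> B"
proof -
  have "compact (f ` {- R..R})"
    by (rule compact_continuous_image[OF continuous_on_subset[OF cont]]) auto
  then obtain B where B: "\<And>x. x \<in> {- R..R} \<Longrightarrow> \<bar>f x\<bar> \<le> B"
    by (metis bounded_iff compact_imp_bounded imageI real_norm_def)
  have "\<bar>f x\<bar> \<le> max 0 B" for x
  proof (cases "\<bar>x\<bar> \<ge> R")
    case False
    then have "x \<in> {- R..R}" by auto
    from B[OF this] show ?thesis by simp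
  qed (simp add: f)
  then show ?thesis using that[of "max 0 B"] by auto
qed

lemma compact_support_absolutely_integrable:
  fixes f :: "real \<Rightarrow> real"
  assumes "\<And>x. \<bar>x\<bar> \<ge> R \<Longrightarrow> f x = 0" "continuous_on UNIV f" "R \<ge> 0"
  shows "f absolutely_integrable_on UNIV"
  using compact_support_bounded[OF assms(1,2)] decays_absolutely_integrable[OF compact_support_decays assms(2)] assms
  by metis

section \<open>The Lasota-Yorke inequality\<close>

definition C1 :: "(real \<Rightarrow> real) \<Rightarrow> (real \<Rightarrow> real) \<Rightarrow> bool" where
  "C1 f f' \<longleftrightarrow> (\<forall>x. (f has_real_derivative f' x) (at x)) \<and> continuous_on UNIV f'"

lemma C1D:
  assumes "C1 f f'"
  shows "(f has_real_derivative f' x) (at x)" "continuous_on S f" "continuous_on S f'"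
proof -
  show *: "(f has_real_derivative f' x) (at x)" for x
    using assms by (simp add: C1_def)
  show "continuous_on S f'"
    using assms by (auto simp: C1_def intro: continuous_on_subset)
  show "continuous_on S f"
    by (rule continuous_at_imp_continuous_on) (blast intro: DERIV_isCont *)
qed

lemma C1_diff: "C1 f f' \<Longrightarrow> C1 g g' \<Longrightarrow> C1 (\<lambda>x. f x - g x) (\<lambda>x. f' x - g' x)"
  unfolding C1_def by (auto intro!: derivative_intros continuous_intros)

lemma C1_minus: "C1 f f' \<Longrightarrow> C1 (\<lambda>x. - f x) (\<lambda>x. - f' x)"
  unfolding C1_def by (auto intro!: derivative_intros continuous_intros)

lemma C1_mult: "C1 f f' \<Longrightarrow> C1 g g' \<Longrightarrow> C1 (\<lambda>x. f x * g x) (\<lambda>x. f' x * g x + g' x * f x)"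
  by (auto simp: C1_def intro!: derivative_intros continuous_intros)
     (use C1D(2)[of f f' UNIV] C1D(2)[of g g' UNIV] in \<open>auto simp: C1_def\<close>)

lemma C1_periodic2:
  assumes "C1 f f'" "periodic2 f"
  shows "periodic2 f'"
  unfolding periodic2_def
proof
  fix x
  have "((\<lambda>x. f (x + 2)) has_real_derivative f' (x + 2)) (at x)"
    using C1D(1)[OF assms(1)] DERIV_shift by blast
  then have "(f has_real_derivative f' (x + 2)) (at x)"
    using assms(2) by (simp add: periodic2_def)
  then show "f' (x + 2) = f' x"
    using DERIV_unique C1D(1)[OF assms(1)] by blast
qed

lemma C1_increment:
  assumes "C1 f f'" "a \<le> x" "x \<le> b"
  shows "\<bar>f x - f a\<bar> \<le> integral {a..b} (\<lambda>x. \<bar>f' x\<bar>)"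
proof -
  have int: "(\<lambda>x. \<bar>f' x\<bar>) integrable_on {s..t}" for s t
    by (intro integrable_continuous_real continuous_intros C1D(3)[OF assms(1)])
  have "(f' has_integral (f x - f a)) {a..x}"
    using assms C1D(1)[OF assms(1)]
    by (intro fundamental_theorem_of_calculus)
       (auto simp: has_real_derivative_iff_has_vector_derivative[symmetric] intro: has_field_derivative_at_within)
  then have "\<bar>f x - f a\<bar> = norm (integral {a..x} f')"
    by (simp add: integral_unique)
  also have "\<dots> \<le> integral {a..x} (\<lambda>x. \<bar>f' x\<bar>)"
    by (intro integral_norm_bound_integral int integrable_continuous_real C1D(3)[OF assms(1)]) auto
  also have "\<dots> \<le> integral {a..b} (\<lambda>x. \<bar>f' x\<bar>)"
    using assms by (intro integral_subset_le int) auto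
  finally show ?thesis .
qed

lemma integral_periodic2:
  assumes "periodic2 f" "continuous_on UNIV f"
  shows "integral {-2..2} f = 2 * integral {0..2} f"
proof -
  have "integral {-2..2} f = integral {-2..0} f + integral {0..2} f"
    by (intro Henstock_Kurzweil_Integration.integral_combine[symmetric] integrable_continuous_real continuous_on_subset[OF assms(2)]) auto
  moreover have "integral {-2..0} f = integral {0..2} f"
    using integral_shift_real_ivl[of 0 2 2 f] assms(1) by (simp add: periodic2_def)
  ultimately show ?thesis by simp
qed

section \<open>Interpolation on a uniform grid of [-2, 2]\<close>

definition node :: "nat \<Rightarrow> nat \<Rightarrow> real" where
  "node m l = -2 + 4 / real m * real l"

text \<open>An interpolant of \<open>u\<close> at the nodes of \<open>[-2, 2]\<close>, written as a sum of jumps so that its variation is bounded by that of \<open>u\<close>.\<close>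

definition interp :: "nat \<Rightarrow> (real \<Rightarrow> real) \<Rightarrow> real \<Rightarrow> real" where
  "interp m u x = u (-2) +
     (\<Sum>l<m. (u (node m (Suc l)) - u (node m l)) * step ((x + 2) / (4 / real m) - real l))"

definition interp' :: "nat \<Rightarrow> (real \<Rightarrow> real) \<Rightarrow> real \<Rightarrow> real" where
  "interp' m u x =
     (\<Sum>l<m. (u (node m (Suc l)) - u (node m l)) * (step' ((x + 2) / (4 / real m) - real l) * (real m / 4)))"

lemma step_deriv_affine:
  "((\<lambda>x. step ((x + 2) / (4 / real m) - real l)) has_real_derivative
     step' ((x + 2) / (4 / real m) - real l) * (real m / 4)) (at x)"
  by (rule DERIV_chain2[OF step_deriv]) (auto intro!: derivative_eq_intros)

lemma interp_C1: "C1 (interp m u) (interp' m u)"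
  unfolding C1_def
proof (intro conjI allI)
  show "(interp m u has_real_derivative interp' m u x) (at x)" for x
    unfolding interp_def [abs_def] interp'_def
    by (rule DERIV_cong[OF DERIV_add[OF DERIV_const DERIV_sum[OF DERIV_cmult[OF step_deriv_affine]]]]) simp
  show "continuous_on UNIV (interp' m u)"
    unfolding interp'_def [abs_def] by (auto intro!: continuous_intros)
qed

lemma node_mono: "k \<le> l \<Longrightarrow> node m k \<le> node m l"
  unfolding node_def by (intro add_left_mono mult_left_mono) auto

lemma integral_nodes:
  fixes f :: "real \<Rightarrow> real"
  assumes "continuous_on UNIV f"
  shows "(\<Sum>l<k. integral {node m l..node m (Suc l)} f) = integral {-2..node m k} f"
proof (induction k)
  case 0
  show ?case by (simp add: node_def)
next
  case (Suc k)
  have "-2 \<le> node m k" by (simp add: node_def)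
  then have "integral {-2..node m k} f + integral {node m k..node m (Suc k)} f = integral {-2..node m (Suc k)} f"
    using node_mono[of k "Suc k" m]
    by (intro Henstock_Kurzweil_Integration.integral_combine integrable_continuous_real
        continuous_on_subset[OF assms]) auto
  then show ?case using Suc by simp
qed

text \<open>Each jump is at most the variation of u on its own cell, and each step contributes total
  variation at most 1 per unit of jump. Hence the bound does not depend on the mesh.\<close>

lemma interp_variation:
  assumes u: "C1 u u'" and m: "m > 0"
  shows "integral {-2..2} (\<lambda>x. \<bar>interp' m u x\<bar>) \<le> integral {-2..2} (\<lambda>x. \<bar>u' x\<bar>)"
proof -
  let ?\<Delta> = "\<lambda>l. u (node m (Suc l)) - u (node m l)"
  let ?s' = "\<lambda>l x. step' ((x + 2) / (4 / real m) - real l) * (real m / 4)"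
  have s': "integral {-2..2} (?s' l) \<le> 1" for l
  proof -
    have "(?s' l has_integral (step ((2 + 2) / (4 / real m) - real l) - step ((-2 + 2) / (4 / real m) - real l))) {-2..2}"
      using step_deriv_affine[of m l]
      by (intro fundamental_theorem_of_calculus)
         (auto simp: has_real_derivative_iff_has_vector_derivative[symmetric] intro: has_field_derivative_at_within)
    then have "integral {-2..2} (?s' l) = step ((2 + 2) / (4 / real m) - real l) - step ((-2 + 2) / (4 / real m) - real l)"
      by (rule integral_unique)
    then show ?thesis
      using step_bounds(2)[of "(2 + 2) / (4 / real m) - real l"] step_bounds(1)[of "(-2 + 2) / (4 / real m) - real l"] by linarith
  qed
  have "integral {-2..2} (\<lambda>x. \<bar>interp' m u x\<bar>) \<le> integral {-2..2} (\<lambda>x. \<Sum>l<m. \<bar>?\<Delta> l\<bar> * ?s' l x)"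
  proof (rule integral_le)
    show "(\<lambda>x. \<bar>interp' m u x\<bar>) integrable_on {-2..2}"
      by (intro integrable_continuous_real continuous_intros C1D(3)[OF interp_C1])
    show "(\<lambda>x. \<Sum>l<m. \<bar>?\<Delta> l\<bar> * ?s' l x) integrable_on {-2..2}"
      by (intro integrable_continuous_real continuous_intros) (use m in auto)
    show "\<bar>interp' m u x\<bar> \<le> (\<Sum>l<m. \<bar>?\<Delta> l\<bar> * ?s' l x)" for x
      unfolding interp'_def by (rule order_trans[OF sum_abs]) (simp add: abs_mult step'_nonneg)
  qed
  also have "\<dots> = (\<Sum>l<m. \<bar>?\<Delta> l\<bar> * integral {-2..2} (?s' l))"
  proof (subst Henstock_Kurzweil_Integration.integral_sum)
    show "(\<lambda>x. \<bar>?\<Delta> l\<bar> * ?s' l x) integrable_on {-2..2}" for l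
      by (intro integrable_continuous_real continuous_intros) (use m in auto)
  qed auto
  also have "\<dots> \<le> (\<Sum>l<m. \<bar>?\<Delta> l\<bar> * 1)"
    by (intro sum_mono mult_left_mono s') auto
  also have "\<dots> \<le> (\<Sum>l<m. integral {node m l..node m (Suc l)} (\<lambda>x. \<bar>u' x\<bar>))"
    by (intro sum_mono) (simp add: C1_increment[OF u] node_mono)
  also have "\<dots> = integral {-2..node m m} (\<lambda>x. \<bar>u' x\<bar>)"
    by (intro integral_nodes continuous_intros C1D(3)[OF u])
  also have "node m m = 2" using m by (simp add: node_def)
  finally show ?thesis .
qed

text \<open>On the k-th cell the steps of earlier cells have already reached 1 and those of later
  cells are still 0, so the earlier jumps telescope to the value of u at the left node.\<close>

lemma interp_cell:
  assumes m: "m > 0" and k: "k < m" and x: "node m k \<le> x" "x \<le> node m (Suc k)"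
  shows "interp m u x = u (node m k) + (u (node m (Suc k)) - u (node m k)) * step ((x + 2) / (4 / real m) - real k)"
proof -
  let ?\<Delta> = "\<lambda>l. u (node m (Suc l)) - u (node m l)"
  let ?t = "(x + 2) / (4 / real m)"
  have t: "real k \<le> ?t" "?t \<le> real k + 1"
    using x m by (auto simp: node_def field_simps)
  have "(\<Sum>l<m. ?\<Delta> l * step (?t - real l)) = (\<Sum>l<Suc k. ?\<Delta> l * step (?t - real l))"
  proof (rule sum.mono_neutral_right)
    show "\<forall>l\<in>{..<m} - {..<Suc k}. ?\<Delta> l * step (?t - real l) = 0"
      using t by (auto intro!: step_eq_0)
  qed (use k in auto)
  also have "\<dots> = (\<Sum>l<k. ?\<Delta> l) + ?\<Delta> k * step (?t - real k)"
    using t by (auto intro!: sum.cong step_eq_1)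
  also have "(\<Sum>l<k. ?\<Delta> l) = u (node m k) - u (node m 0)"
    by (rule sum_lessThan_telescope)
  finally show ?thesis
    unfolding interp_def by (simp add: node_def)
qed

text \<open>On each cell both the increment of u and that of the interpolant from the left node are
  at most the variation of u there. Twice this variation times the cell length 4/m gives the factor
  8/m.\<close>

lemma interp_error:
  assumes u: "C1 u u'" and m: "m > 0"
  shows "integral {-2..2} (\<lambda>x. \<bar>u x - interp m u x\<bar>) \<le> 8 / real m * integral {-2..2} (\<lambda>x. \<bar>u' x\<bar>)"
proof -
  let ?V = "\<lambda>l. integral {node m l..node m (Suc l)} (\<lambda>x. \<bar>u' x\<bar>)"
  have cont: "continuous_on S (\<lambda>x. \<bar>u x - interp m u x\<bar>)" for S
    by (intro continuous_intros C1D(2)[OF u] C1D(2)[OF interp_C1])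
  have "integral {-2..2} (\<lambda>x. \<bar>u x - interp m u x\<bar>) = integral {-2..node m m} (\<lambda>x. \<bar>u x - interp m u x\<bar>)"
    using m by (simp add: node_def)
  also have "\<dots> = (\<Sum>k<m. integral {node m k..node m (Suc k)} (\<lambda>x. \<bar>u x - interp m u x\<bar>))"
    by (rule integral_nodes[symmetric, OF cont])
  also have "\<dots> \<le> (\<Sum>k<m. 8 / real m * ?V k)"
  proof (rule sum_mono)
    fix k assume "k \<in> {..<m}"
    then have k: "k < m" by simp
    have "\<bar>u x - interp m u x\<bar> \<le> 2 * ?V k" if x: "x \<in> {node m k..node m (Suc k)}" for x
    proof -
      have "\<bar>u x - u (node m k)\<bar> \<le> ?V k"
        using C1_increment[OF u] x by auto
      moreover have "\<bar>u (node m (Suc k)) - u (node m k)\<bar> * \<bar>step ((x + 2) / (4 / real m) - real k)\<bar> \<le> ?V k * 1"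
        using C1_increment[OF u] node_mono[of k "Suc k" m] step_bounds
          order_trans[OF abs_ge_zero C1_increment[OF u, of "node m k" "node m k" "node m (Suc k)"]]
        by (intro mult_mono) auto
      ultimately show ?thesis
        using interp_cell[OF m k, of x u] x unfolding abs_mult[symmetric] by auto
    qed
    then have "integral {node m k..node m (Suc k)} (\<lambda>x. \<bar>u x - interp m u x\<bar>)
        \<le> integral {node m k..node m (Suc k)} (\<lambda>x. 2 * ?V k)"
      by (intro integral_le integrable_continuous_real cont) auto
    also have "\<dots> = (node m (Suc k) - node m k) * (2 * ?V k)"
      using node_mono[of k "Suc k" m] by simp
    also have "node m (Suc k) - node m k = 4 / real m"
      by (simp add: node_def distrib_left)
    also have "4 / real m * (2 * ?V k) = 8 / real m * ?V k"
      by simp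
    finally show "integral {node m k..node m (Suc k)} (\<lambda>x. \<bar>u x - interp m u x\<bar>) \<le> 8 / real m * ?V k" .
  qed
  also have "\<dots> = 8 / real m * integral {-2..node m m} (\<lambda>x. \<bar>u' x\<bar>)"
    unfolding sum_distrib_left[symmetric]
    by (subst integral_nodes) (auto intro!: continuous_intros C1D(3)[OF u])
  also have "node m m = 2" using m by (simp add: node_def)
  finally show ?thesis .
qed

text \<open>The cutoff will have support in [-c, c]. Here c > 1 leaves room for a smooth partition
  of unity by translates, c < 2 limits the overlap to neighbouring translates, and c^2 < \<beta>
  makes the inversion expanding on the support and leaves the gap between c and
  \<open>sqrt \<beta>\<close> free.\<close>

locale lattice_cross =
  fixes \<beta> c :: real
  assumes c1: "1 < c" and c2: "c < 2" and c_sq: "c\<^sup>2 < \<beta>"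
begin

lemma beta_pos: "\<beta> > 0"
  using c_sq zero_le_power2[of c] by linarith

sublocale support_bound \<beta> c
  by unfold_locales (use beta_pos c1 in auto)

text \<open>Being of the form \<open>T x - T (x - 2)\<close>, the translates telescope to \<open>1\<close>.\<close>

definition chi :: "real \<Rightarrow> real" where
  "chi x = step ((x + c) / (2 * (c - 1))) - step ((x - 2 + c) / (2 * (c - 1)))"

definition chi' :: "real \<Rightarrow> real" where
  "chi' x = (step' ((x + c) / (2 * (c - 1))) - step' ((x - 2 + c) / (2 * (c - 1)))) / (2 * (c - 1))"

lemma chi_C1: "C1 chi chi'"
  unfolding C1_def
proof (intro conjI allI)
  have d: "((\<lambda>x. step ((x + a) / (2 * (c - 1)))) has_real_derivative
      step' ((x + a) / (2 * (c - 1))) * (1 / (2 * (c - 1)))) (at x)" for x a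
    by (rule DERIV_chain2[OF step_deriv]) (use c1 in \<open>auto intro!: derivative_eq_intros\<close>)
  show "(chi has_real_derivative chi' x) (at x)" for x
    using DERIV_diff[OF d[of c x] d[of "- 2 + c" x]]
    unfolding chi_def [abs_def] chi'_def by (simp add: diff_divide_distrib algebra_simps)
  show "continuous_on UNIV chi'"
    unfolding chi'_def [abs_def] using c1 by (auto intro!: continuous_intros)
qed

lemma chi_nonneg: "0 \<le> chi x"
  unfolding chi_def using c1 by (simp add: step_mono divide_right_mono)

lemma chi_le_1: "chi x \<le> 1"
  unfolding chi_def using step_bounds[of "(x + c) / (2 * (c - 1))"] step_bounds[of "(x - 2 + c) / (2 * (c - 1))"] by linarith

lemma chi_eq_0:
  assumes "\<bar>x\<bar> \<ge> c"
  shows "chi x = 0" "chi' x = 0"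
proof -
  consider "x \<le> - c" | "x \<ge> c" using assms by linarith
  then have "chi x = 0 \<and> chi' x = 0"
  proof cases
    case 1
    then have "(x + c) / (2 * (c - 1)) \<le> 0" "(x - 2 + c) / (2 * (c - 1)) \<le> 0"
      using c1 by (auto intro!: divide_nonpos_pos)
    then show ?thesis by (simp add: chi_def chi'_def step_eq_0)
  next
    case 2
    then have "(x + c) / (2 * (c - 1)) \<ge> 1" "(x - 2 + c) / (2 * (c - 1)) \<ge> 1"
      using c1 by (auto simp: pos_le_divide_eq)
    then show ?thesis by (simp add: chi_def chi'_def step_eq_1)
  qed
  then show "chi x = 0" "chi' x = 0" by auto
qed

text \<open>The sum telescopes to T x - T (x - 4), and c < 2 makes these end terms 1 and 0 on
  [0, 2].\<close>

lemma chi_sum: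
  assumes "0 \<le> x" "x \<le> 2"
  shows "chi x + chi (x - 2) = 1"
proof -
  have "(x + c) / (2 * (c - 1)) \<ge> 1" "(x - 4 + c) / (2 * (c - 1)) \<le> 0"
    using assms c1 c2 by (auto simp: pos_le_divide_eq intro!: divide_nonpos_pos)
  then show ?thesis
    by (simp add: chi_def step_eq_0 step_eq_1)
qed

text \<open>Every bounded periodic function is thus the periodization of a function of bounded
  support. After reduction to [0, 2) only the term n = 0, that is the translates y and y - 2, meets
  the support of the cutoff.\<close>

lemma per_cutoff:
  assumes u: "periodic2 u" and B: "\<And>x. \<bar>u x\<bar> \<le> B"
  shows "per (\<lambda>x. chi x * u x) x = u x" "decays (\<lambda>x. chi x * u x) (B * 5)"
proof -
  have "\<bar>chi x * u x\<bar> \<le> 1 * B" for x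
    unfolding abs_mult using chi_nonneg chi_le_1 B by (intro mult_mono) auto
  \<comment> \<open>The constant is 1 + 2^2 for the support radius 2.\<close>
  then show d: "decays (\<lambda>x. chi x * u x) (B * 5)"
    using compact_support_decays[of 2 "\<lambda>x. chi x * u x" B] c2 chi_eq_0 by simp
  obtain y where y: "0 \<le> y" "y < 2" and red: "\<And>f. periodic2 f \<Longrightarrow> f x = f y"
    using periodic2_reduce[of x] by blast
  have "per (\<lambda>x. chi x * u x) y = (\<Sum>n\<in>{0}. chi (y + 2 * real n) * u (y + 2 * real n)
      + chi (y - 2 * real n - 2) * u (y - 2 * real n - 2))"
    unfolding per_def
  proof (rule suminf_finite)
    fix n :: nat assume "n \<notin> {0}"
    then have "real n \<ge> 1" by simp
    then have "c \<le> \<bar>y + 2 * real n\<bar>" "c \<le> \<bar>y - 2 * real n - 2\<bar>"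
      using y c2 by auto
    then show "chi (y + 2 * real n) * u (y + 2 * real n) + chi (y - 2 * real n - 2) * u (y - 2 * real n - 2) = 0"
      by (simp add: chi_eq_0)
  qed simp
  also have "\<dots> = (chi y + chi (y - 2)) * u y"
    using periodic2_shift_nat(2)[OF u, of y 1] by (simp add: distrib_right)
  also have "\<dots> = u y" using chi_sum y by simp
  finally show "per (\<lambda>x. chi x * u x) x = u x"
    using red[OF u] red[OF per_periodic2[OF d]] by simp
qed

lemma chi_integral:
  assumes u: "periodic2 u" "continuous_on UNIV u"
  shows "integral UNIV (\<lambda>x. chi x * u x) = integral {0..2} u"
proof -
  obtain B where B: "\<And>x. \<bar>u x\<bar> \<le> B"
  proof -
    have "compact (u ` {0..2})"
      by (rule compact_continuous_image[OF continuous_on_subset[OF u(2)]]) auto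
    then obtain B where B: "\<And>x. x \<in> {0..2} \<Longrightarrow> \<bar>u x\<bar> \<le> B"
      by (metis bounded_iff compact_imp_bounded imageI real_norm_def)
    have "\<bar>u x\<bar> \<le> B" for x
      using periodic2_reduce[of x] B u(1) by (metis atLeastAtMost_iff less_imp_le)
    then show ?thesis using that by blast
  qed
  have "integral UNIV (\<lambda>x. chi x * u x) = integral {0..2} (per (\<lambda>x. chi x * u x))"
    by (rule per_integral[symmetric, OF per_cutoff(2)[OF u(1) B]])
       (intro continuous_intros u(2) C1D(2)[OF chi_C1])
  also have "per (\<lambda>x. chi x * u x) = u"
    using per_cutoff(1)[OF u(1) B] by blast
  finally show ?thesis .
qed

text \<open>The inversion preserves the integral of the absolute value, and periodization does not
  increase it.\<close>

lemma per_push_abs_integral: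
  assumes f: "\<And>x. \<bar>x\<bar> \<ge> c \<Longrightarrow> f x = 0" and cont: "continuous_on UNIV f"
  shows "integral {0..2} (\<lambda>x. \<bar>per (inv_push \<beta> f) x\<bar>) \<le> integral UNIV (\<lambda>x. \<bar>f x\<bar>)"
proof -
  obtain B where B: "\<And>x. \<bar>f x\<bar> \<le> B"
    using compact_support_bounded[OF f cont] by blast
  have "integral {0..2} (\<lambda>x. \<bar>per (inv_push \<beta> f) x\<bar>) \<le> integral UNIV (\<lambda>x. \<bar>inv_push \<beta> f x\<bar>)"
    by (rule per_abs_integral[OF inv_push_decays[OF f B] inv_push_continuous[OF f cont]])
  also have "(\<lambda>x. \<bar>inv_push \<beta> f x\<bar>) = inv_push \<beta> (\<lambda>x. \<bar>f x\<bar>)"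
    using \<beta>_pos by (auto simp: inv_push_def abs_mult abs_divide)
  also have "integral UNIV (inv_push \<beta> (\<lambda>x. \<bar>f x\<bar>)) = integral UNIV (\<lambda>x. \<bar>f x\<bar>)"
    using c1 by (intro inv_push_integral[OF \<beta>_pos] compact_support_absolutely_integrable[of c])
       (auto simp: f intro!: continuous_intros cont)
  finally show ?thesis .
qed

section \<open>The transfer operator and its effect on norm and variation\<close>

definition transfer :: "(real \<Rightarrow> real) \<Rightarrow> real \<Rightarrow> real" where
  "transfer u x = - per (inv_push \<beta> (\<lambda>x. chi x * u x)) x"

definition periodic_var :: "(real \<Rightarrow> real) \<Rightarrow> real \<Rightarrow> real \<Rightarrow> bool" where
  "periodic_var u a w \<longleftrightarrow> (\<exists>u'. C1 u u' \<and> periodic2 u \<and>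
     integral {0..2} (\<lambda>x. \<bar>u x\<bar>) \<le> a \<and> integral {0..2} (\<lambda>x. \<bar>u' x\<bar>) \<le> w)"

text \<open>An interpolation remainder is not periodic, so the input of \<open>transfer\<close> is
  measured only where the cutoff sees it. The unweighted integral over [-2, 2] controls the term
  with the derivative of the cutoff; its bound \<open>2 * a\<close> reflects that [-2, 2] consists
  of two periods.\<close>

definition local_var :: "(real \<Rightarrow> real) \<Rightarrow> real \<Rightarrow> real \<Rightarrow> bool" where
  "local_var u a w \<longleftrightarrow> (\<exists>u'. C1 u u' \<and> integral {-2..2} (\<lambda>x. \<bar>u x\<bar>) \<le> 2 * a \<and>
     integral UNIV (\<lambda>x. chi x * \<bar>u x\<bar>) \<le> a \<and> integral UNIV (\<lambda>x. chi x * \<bar>u' x\<bar>) \<le> w)"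

lemma periodic_imp_local_var: "periodic_var u a w \<Longrightarrow> local_var u a w"
proof -
  assume "periodic_var u a w"
  then obtain u' where u': "C1 u u'" "periodic2 u" "integral {0..2} (\<lambda>x. \<bar>u x\<bar>) \<le> a" "integral {0..2} (\<lambda>x. \<bar>u' x\<bar>) \<le> w"
    unfolding periodic_var_def by blast
  have "periodic2 (\<lambda>x. \<bar>u x\<bar>)" "periodic2 (\<lambda>x. \<bar>u' x\<bar>)"
    using u'(2) C1_periodic2[OF u'(1,2)] by (auto simp: periodic2_def)
  moreover have "continuous_on UNIV (\<lambda>x. \<bar>u x\<bar>)" "continuous_on UNIV (\<lambda>x. \<bar>u' x\<bar>)"
    by (intro continuous_intros C1D[OF u'(1)])+
  ultimately show ?thesis
    unfolding local_var_def using u' by (auto simp: chi_integral integral_periodic2)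
qed

text \<open>The largest value of x^2 / \<beta> on [-c, c], hence the largest inverse expansion rate
  of the inversion there: the contraction factor of the Lasota-Yorke inequality.\<close>

definition "ratio = c\<^sup>2 / \<beta>"

lemma ratio: "0 \<le> ratio" "ratio < 1"
  using c_sq \<beta>_pos by (auto simp: ratio_def)

text \<open>Some bound for the derivative of x^2 \<open>chi x\<close>, which is finite by compact
  support. The normalization 2 / \<beta> absorbs the division by \<beta> and the factor 1/2 that
  compensates the bound \<open>2 * a\<close> in \<open>local_var\<close>.\<close>

definition "distortion = (SOME M. M \<ge> 0 \<and> (\<forall>x. \<bar>2 * x * chi x + x\<^sup>2 * chi' x\<bar> \<le> M)) * 2 / \<beta>"

lemma distortion: "distortion \<ge> 0" "\<bar>2 * x * chi x + x\<^sup>2 * chi' x\<bar> \<le> distortion * \<beta> / 2"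
proof -
  let ?P = "\<lambda>M. M \<ge> 0 \<and> (\<forall>x. \<bar>2 * x * chi x + x\<^sup>2 * chi' x\<bar> \<le> M)"
  obtain M where "?P M"
    by (rule compact_support_bounded[of c "\<lambda>x. 2 * x * chi x + x\<^sup>2 * chi' x"])
       (auto simp: chi_eq_0 intro!: continuous_intros C1D[OF chi_C1])
  then have "?P (SOME M. ?P M)" by (rule someI)
  then show "distortion \<ge> 0" "\<bar>2 * x * chi x + x\<^sup>2 * chi' x\<bar> \<le> distortion * \<beta> / 2"
    unfolding distortion_def using \<beta>_pos by auto
qed

text \<open>The sign in \<open>transfer\<close> cancels the one in the derivative of an image under
  the inversion.\<close>

lemma transfer_deriv:
  assumes u: "C1 u u'"
  shows "C1 (transfer u) (per (inv_push \<beta> (\<lambda>x. (2 * x * (chi x * u x) + x\<^sup>2 * (chi' x * u x + u' x * chi x)) / \<beta>)))"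
proof -
  let ?f = "\<lambda>x. chi x * u x"
  let ?f' = "\<lambda>x. chi' x * u x + u' x * chi x"
  let ?g = "\<lambda>x. (2 * x * ?f x + x\<^sup>2 * ?f' x) / \<beta>"
  have f: "C1 ?f ?f'" by (rule C1_mult[OF chi_C1 u])
  have f0: "?f x = 0" "?f' x = 0" if "\<bar>x\<bar> \<ge> c" for x
    using chi_eq_0[OF that] by simp_all
  have g0: "?g x = 0" if "\<bar>x\<bar> \<ge> c" for x
    using f0[OF that] by simp
  have gc: "continuous_on UNIV ?g"
    by (intro continuous_intros C1D[OF chi_C1] C1D[OF u]) (use \<beta>_pos in auto)
  obtain B where B: "\<And>x. \<bar>?f x\<bar> \<le> B"
    using compact_support_bounded[OF f0(1) C1D(2)[OF f]] by blast
  obtain D where D: "\<And>x. \<bar>?g x\<bar> \<le> D"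
    using compact_support_bounded[OF g0 gc] by blast
  note dg = inv_push_decays[OF g0 D]
  have dg': "decays (\<lambda>x. - inv_push \<beta> ?g x) (D * (c\<^sup>2 / \<beta> + \<beta>))"
    using dg by (simp add: decays_def)
  have d: "(per (inv_push \<beta> ?f) has_real_derivative per (\<lambda>x. - inv_push \<beta> ?g x) x) (at x)" for x
    by (rule per_deriv[OF inv_push_decays[OF f0(1) B] dg' inv_push_deriv[OF f0 C1D(1)[OF f]]])
  have "per (\<lambda>x. - inv_push \<beta> ?g x) x = - per (inv_push \<beta> ?g) x" for x
    using per_cmult[OF dg, where c = "- 1" and y = x] by simp
  then have "(transfer u has_real_derivative per (inv_push \<beta> ?g) x) (at x)" for x
    unfolding transfer_def [abs_def] using DERIV_minus[OF d[of x]] by simp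
  moreover have "continuous_on UNIV (per (inv_push \<beta> ?g))"
    by (rule per_continuous[OF dg inv_push_continuous[OF g0 gc]])
  ultimately show ?thesis unfolding C1_def by blast
qed

text \<open>The Lasota-Yorke inequality. The product rule splits (x^2 \<open>chi\<close> u)' /
  \<beta> into x^2 \<open>chi\<close> u' / \<beta>, where x^2 / \<beta> is at most
  \<open>ratio\<close> on the support, and (x^2 \<open>chi\<close>)' u / \<beta>, which costs only
  the integral of |u|.\<close>

lemma transfer_var:
  assumes "local_var u a w"
  shows "periodic_var (transfer u) a (ratio * w + distortion * a)"
proof -
  obtain u' where u: "C1 u u'" and u2: "integral {-2..2} (\<lambda>x. \<bar>u x\<bar>) \<le> 2 * a"
    and ua: "integral UNIV (\<lambda>x. chi x * \<bar>u x\<bar>) \<le> a" and uw: "integral UNIV (\<lambda>x. chi x * \<bar>u' x\<bar>) \<le> w"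
    using assms unfolding local_var_def by blast
  let ?f = "\<lambda>x. chi x * u x"
  let ?g = "\<lambda>x. (2 * x * ?f x + x\<^sup>2 * (chi' x * u x + u' x * chi x)) / \<beta>"
  have f0: "?f x = 0" if "\<bar>x\<bar> \<ge> c" for x
    using chi_eq_0[OF that] by simp
  have g0: "?g x = 0" if "\<bar>x\<bar> \<ge> c" for x
    using chi_eq_0[OF that] by simp
  have fc: "continuous_on UNIV ?f"
    by (intro continuous_intros C1D[OF chi_C1] C1D[OF u])
  have gc: "continuous_on UNIV ?g"
    by (intro continuous_intros C1D[OF chi_C1] C1D[OF u]) (use \<beta>_pos in auto)
  obtain B where B: "\<And>x. \<bar>?f x\<bar> \<le> B"
    using compact_support_bounded[OF f0 fc] by blast
  have "periodic2 (transfer u)"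
    using per_periodic2[OF inv_push_decays[OF f0 B]] by (simp add: periodic2_def transfer_def)
  moreover have "integral {0..2} (\<lambda>x. \<bar>transfer u x\<bar>) \<le> a"
  proof -
    have "integral {0..2} (\<lambda>x. \<bar>transfer u x\<bar>) \<le> integral UNIV (\<lambda>x. \<bar>?f x\<bar>)"
      unfolding transfer_def abs_minus_cancel by (rule per_push_abs_integral[OF f0 fc])
    then show ?thesis using ua by (simp add: abs_mult chi_nonneg)
  qed
  moreover have "integral {0..2} (\<lambda>x. \<bar>per (inv_push \<beta> ?g) x\<bar>) \<le> ratio * w + distortion * a"
  proof -
    have intw: "(\<lambda>x. chi x * \<bar>u' x\<bar>) integrable_on UNIV"
      by (rule set_lebesgue_integral_eq_integral(1), rule compact_support_absolutely_integrable[of c])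
         (use c1 in \<open>auto simp: chi_eq_0 intro!: continuous_intros C1D[OF chi_C1] C1D[OF u]\<close>)
    have int2: "(\<lambda>x. if x \<in> {-2..2} then \<bar>u x\<bar> else 0) integrable_on UNIV"
      unfolding integrable_restrict_UNIV
      by (intro integrable_continuous_real continuous_intros C1D[OF u])
    have intg: "(\<lambda>x. \<bar>?g x\<bar>) integrable_on UNIV"
      by (rule set_lebesgue_integral_eq_integral(1), rule compact_support_absolutely_integrable[of c])
         (use c1 \<beta>_pos in \<open>auto simp: chi_eq_0 intro!: continuous_intros C1D[OF chi_C1] C1D[OF u]\<close>)
    have "integral UNIV (\<lambda>x. \<bar>?g x\<bar>) \<le> integral UNIV (\<lambda>x. ratio * (chi x * \<bar>u' x\<bar>)
        + distortion / 2 * (if x \<in> {-2..2} then \<bar>u x\<bar> else 0))"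
    proof (rule integral_le[OF intg])
      show "(\<lambda>x. ratio * (chi x * \<bar>u' x\<bar>) + distortion / 2 * (if x \<in> {-2..2} then \<bar>u x\<bar> else 0)) integrable_on UNIV"
        by (intro integrable_add integrable_on_mult_right intw int2)
      fix x
      show "\<bar>?g x\<bar> \<le> ratio * (chi x * \<bar>u' x\<bar>) + distortion / 2 * (if x \<in> {-2..2} then \<bar>u x\<bar> else 0)"
      proof (cases "\<bar>x\<bar> \<ge> c")
        case True
        then show ?thesis
          using chi_eq_0[OF True] distortion(1) ratio(1) chi_nonneg by simp
      next
        case False
        then have x2: "x \<in> {-2..2}" using c2 by auto
        have xc: "x\<^sup>2 \<le> c\<^sup>2"
          using False by (metis abs_ge_zero linear power2_abs power_mono)
        have "?g x * \<beta> = 2 * x * ?f x + x\<^sup>2 * (chi' x * u x + u' x * chi x)"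
          using \<beta>_pos by simp
        also have "\<dots> = (2 * x * chi x + x\<^sup>2 * chi' x) * u x + x\<^sup>2 * (chi x * u' x)"
          by (simp add: algebra_simps)
        finally have "\<bar>?g x * \<beta>\<bar> \<le> \<bar>2 * x * chi x + x\<^sup>2 * chi' x\<bar> * \<bar>u x\<bar> + x\<^sup>2 * (chi x * \<bar>u' x\<bar>)"
          using chi_nonneg[of x] by (simp add: abs_mult order_trans[OF abs_triangle_ineq])
        also have "\<dots> \<le> distortion * \<beta> / 2 * \<bar>u x\<bar> + c\<^sup>2 * (chi x * \<bar>u' x\<bar>)"
          using distortion(2) xc chi_nonneg by (intro add_mono mult_right_mono) auto
        also have "\<bar>?g x * \<beta>\<bar> = \<bar>?g x\<bar> * \<beta>"
          using \<beta>_pos by (simp only: abs_mult abs_of_pos)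
        also have "distortion * \<beta> / 2 * \<bar>u x\<bar> + c\<^sup>2 * (chi x * \<bar>u' x\<bar>)
            = (ratio * (chi x * \<bar>u' x\<bar>) + distortion / 2 * \<bar>u x\<bar>) * \<beta>"
          using \<beta>_pos by (simp add: ratio_def algebra_simps)
        finally have "\<bar>?g x\<bar> * \<beta> \<le> (ratio * (chi x * \<bar>u' x\<bar>) + distortion / 2 * \<bar>u x\<bar>) * \<beta>" .
        then show ?thesis
          using \<beta>_pos x2 by (simp only: mult_le_cancel_right_pos if_True)
      qed
    qed
    also have "\<dots> = ratio * integral UNIV (\<lambda>x. chi x * \<bar>u' x\<bar>)
        + distortion / 2 * integral {-2..2} (\<lambda>x. \<bar>u x\<bar>)"
      by (subst Henstock_Kurzweil_Integration.integral_add[OF integrable_on_mult_right[OF intw] integrable_on_mult_right[OF int2]])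
         (simp only: integral_mult_right integral_restrict_UNIV)
    also have "\<dots> \<le> ratio * w + distortion / 2 * (2 * a)"
      using ratio distortion by (intro add_mono mult_left_mono uw u2) auto
    finally show ?thesis
      using per_push_abs_integral[OF g0 gc] by simp
  qed
  ultimately show ?thesis
    unfolding periodic_var_def using transfer_deriv[OF u] by blast
qed

end

section \<open>Solving the equation modulo a finite-dimensional space\<close>

instance bcontfun :: (metric_space, banach) banach ..

lemma bounded_linear_funpow:
  fixes Q :: "'a::real_normed_vector \<Rightarrow> 'a"
  assumes "bounded_linear Q"
  shows "bounded_linear (Q ^^ n)"
  by (induction n) (auto simp: id_def o_def intro: bounded_linear_ident bounded_linear_compose[OF assms])

text \<open>The Neumann sum U satisfies U = r + Q^n (U - E U), and u = U + Q U + ... + Q^(n-1) U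
  telescopes to u - Q u = U - Q^n U. Summability is asked only along the orbit of r, because the
  contraction will hold for the variation and not for the norm of the space.\<close>

lemma finite_rank_defect_solution:
  fixes Q E :: "'a::banach \<Rightarrow> 'a"
  assumes Q: "bounded_linear Q" and E: "bounded_linear E"
    and sm: "summable (\<lambda>k. ((\<lambda>u. (Q ^^ n) (u - E u)) ^^ k) r)"
  obtains u U where "u - Q u = r - (Q ^^ n) (E U)"
proof -
  let ?N = "\<lambda>u. (Q ^^ n) (u - E u)"
  have Qn: "bounded_linear (Q ^^ n)" by (rule bounded_linear_funpow[OF Q])
  have N: "bounded_linear ?N"
    by (intro bounded_linear_compose[OF Qn] bounded_linear_sub bounded_linear_ident E)
  define U where "U = (\<Sum>k. (?N ^^ k) r)"
  have "U = r + (\<Sum>k. (?N ^^ Suc k) r)"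
    unfolding U_def using suminf_split_head[OF sm] by simp
  also have "(\<Sum>k. (?N ^^ Suc k) r) = ?N U"
    unfolding U_def using bounded_linear.suminf[OF N sm] by simp
  finally have U: "U = r + (Q ^^ n) U - (Q ^^ n) (E U)"
    by (simp add: linear_diff[OF bounded_linear.linear[OF Qn]] add_diff_eq)
  have "(\<Sum>i<n. (Q ^^ i) U) - Q (\<Sum>i<n. (Q ^^ i) U) = U - (Q ^^ n) U"
    using sum_lessThan_telescope'[of "\<lambda>i. (Q ^^ i) U" n]
    by (simp add: linear_sum[OF bounded_linear.linear[OF Q]] sum_subtractf)
  then have "(\<Sum>i<n. (Q ^^ i) U) - Q (\<Sum>i<n. (Q ^^ i) U) = r - (Q ^^ n) (E U)"
    using U by (metis add_diff_cancel_right' diff_add_eq diff_diff_eq2 add.commute)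
  then show ?thesis by (rule that)
qed

section \<open>Interpolation as a finite-rank operator on bounded continuous functions\<close>

lemma abs_apply_bcontfun_le: "\<bar>apply_bcontfun (u :: real \<Rightarrow>\<^sub>C real) x\<bar> \<le> norm u"
  using norm_bounded[of u x] by simp

lemma bounded_linear_eval: "bounded_linear (\<lambda>u :: real \<Rightarrow>\<^sub>C real. apply_bcontfun u x)"
  by (rule bounded_linear_intro[where K = 1]) (auto simp: abs_apply_bcontfun_le)

lemma apply_bcontfun_sum: "apply_bcontfun (sum f A :: real \<Rightarrow>\<^sub>C real) x = (\<Sum>i\<in>A. apply_bcontfun (f i) x)"
  by (rule linear_sum[OF bounded_linear.linear[OF bounded_linear_eval]])

text \<open>The indices below m are the steps of the cells; index m is the constant function, whose
  coefficient is the value at -2. The range is thus spanned by m + 1 functions.\<close>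

definition interp_elt :: "nat \<Rightarrow> nat \<Rightarrow> (real \<Rightarrow>\<^sub>C real)" where
  "interp_elt m l = (if l < m then Bcontfun (\<lambda>x. step ((x + 2) / (4 / real m) - real l)) else const_bcontfun 1)"

definition interp_coeff :: "nat \<Rightarrow> nat \<Rightarrow> (real \<Rightarrow>\<^sub>C real) \<Rightarrow> real" where
  "interp_coeff m l u = (if l < m then apply_bcontfun u (node m (Suc l)) - apply_bcontfun u (node m l)
     else apply_bcontfun u (-2))"

definition interp_op :: "nat \<Rightarrow> (real \<Rightarrow>\<^sub>C real) \<Rightarrow> (real \<Rightarrow>\<^sub>C real)" where
  "interp_op m u = (\<Sum>l<Suc m. interp_coeff m l u *\<^sub>R interp_elt m l)"

lemma apply_interp_elt:
  assumes "l < m"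
  shows "apply_bcontfun (interp_elt m l) x = step ((x + 2) / (4 / real m) - real l)"
proof -
  have "(\<lambda>x. step ((x + 2) / (4 / real m) - real l)) \<in> bcontfun"
    using assms step_bounds by (intro bcontfun_normI[where b = 1] continuous_intros) auto
  then show ?thesis
    using assms by (simp add: interp_elt_def Bcontfun_inverse)
qed

lemma apply_interp_op: "apply_bcontfun (interp_op m u) = interp m (apply_bcontfun u)"
proof
  fix x
  have "(\<Sum>l<m. interp_coeff m l u * apply_bcontfun (interp_elt m l) x)
      = (\<Sum>l<m. (apply_bcontfun u (node m (Suc l)) - apply_bcontfun u (node m l)) * step ((x + 2) / (4 / real m) - real l))"
    by (intro sum.cong) (auto simp: interp_coeff_def apply_interp_elt)
  moreover have "interp_coeff m m u * apply_bcontfun (interp_elt m m) x = apply_bcontfun u (-2)"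
    by (simp add: interp_coeff_def interp_elt_def const_bcontfun.rep_eq)
  ultimately show "apply_bcontfun (interp_op m u) x = interp m (apply_bcontfun u) x"
    by (simp add: interp_op_def apply_bcontfun_sum interp_def)
qed

lemma bounded_linear_interp_op: "bounded_linear (interp_op m)"
proof -
  have "bounded_linear (interp_coeff m l)" for l
    unfolding interp_coeff_def [abs_def]
    by (cases "l < m") (auto intro: bounded_linear_sub bounded_linear_eval)
  then show ?thesis
    unfolding interp_op_def [abs_def]
    by (intro bounded_linear_sum bounded_linear_scaleR_const)
qed

context lattice_cross
begin

lemma cutoff_mult:
  assumes u: "continuous_on UNIV u" and B: "\<And>x. \<bar>u x\<bar> \<le> B"
  shows "\<bar>x\<bar> \<ge> c \<Longrightarrow> chi x * u x = 0" "continuous_on UNIV (\<lambda>x. chi x * u x)" "\<bar>chi x * u x\<bar> \<le> B"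
    "decays (inv_push \<beta> (\<lambda>x. chi x * u x)) (B * (c\<^sup>2 / \<beta> + \<beta>))"
proof -
  show *: "chi x * u x = 0" if "\<bar>x\<bar> \<ge> c" for x using chi_eq_0[OF that] by simp
  show "continuous_on UNIV (\<lambda>x. chi x * u x)"
    by (intro continuous_intros C1D[OF chi_C1] u)
  have "\<bar>chi x * u x\<bar> \<le> 1 * B" for x
    unfolding abs_mult using chi_nonneg chi_le_1 B by (intro mult_mono) auto
  then show B': "\<bar>chi x * u x\<bar> \<le> B" for x by simp
  show "decays (inv_push \<beta> (\<lambda>x. chi x * u x)) (B * (c\<^sup>2 / \<beta> + \<beta>))"
    by (rule inv_push_decays[OF * B'])
qed

definition transfer_op :: "(real \<Rightarrow>\<^sub>C real) \<Rightarrow> (real \<Rightarrow>\<^sub>C real)" where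
  "transfer_op u = Bcontfun (transfer (apply_bcontfun u))"

lemma transfer_bound:
  assumes u: "continuous_on UNIV u" and B: "\<And>x. \<bar>u x\<bar> \<le> B"
  shows "continuous_on UNIV (transfer u)" "\<bar>transfer u x\<bar> \<le> 10 * decay_sum * (B * (c\<^sup>2 / \<beta> + \<beta>))"
proof -
  note f = cutoff_mult[OF assms]
  show "continuous_on UNIV (transfer u)"
    unfolding transfer_def [abs_def]
    by (intro continuous_intros per_continuous[OF f(4) inv_push_continuous[OF f(1) f(2)]])
  show "\<bar>transfer u x\<bar> \<le> 10 * decay_sum * (B * (c\<^sup>2 / \<beta> + \<beta>))"
    unfolding transfer_def abs_minus_cancel by (rule per_bound[OF f(4)])
qed

lemma apply_transfer_op: "apply_bcontfun (transfer_op u) = transfer (apply_bcontfun u)"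
  unfolding transfer_op_def
  by (rule Bcontfun_inverse)
     (rule bcontfun_normI, rule transfer_bound[OF _ abs_apply_bcontfun_le], simp,
      unfold real_norm_def, rule transfer_bound[OF _ abs_apply_bcontfun_le], simp)

lemma bounded_linear_transfer_op: "bounded_linear transfer_op"
proof (rule bounded_linear_intro)
  note d = cutoff_mult(4)[OF continuous_on_apply_bcontfun abs_apply_bcontfun_le]
  show "transfer_op (u + v) = transfer_op u + transfer_op v" for u v
  proof (rule bcontfun_eqI)
    fix x
    have "inv_push \<beta> (\<lambda>x. chi x * apply_bcontfun (u + v) x)
        = (\<lambda>y. inv_push \<beta> (\<lambda>x. chi x * apply_bcontfun u x) y + inv_push \<beta> (\<lambda>x. chi x * apply_bcontfun v x) y)"
      by (simp add: inv_push_def fun_eq_iff distrib_left distrib_right add_divide_distrib)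
    then show "apply_bcontfun (transfer_op (u + v)) x = apply_bcontfun (transfer_op u + transfer_op v) x"
      by (simp add: apply_transfer_op transfer_def per_add[OF d d])
  qed
  show "transfer_op (a *\<^sub>R u) = a *\<^sub>R transfer_op u" for a u
  proof (rule bcontfun_eqI)
    fix x
    have "inv_push \<beta> (\<lambda>x. chi x * apply_bcontfun (a *\<^sub>R u) x)
        = (\<lambda>y. a * inv_push \<beta> (\<lambda>x. chi x * apply_bcontfun u x) y)"
      by (simp add: inv_push_def fun_eq_iff mult_ac)
    then show "apply_bcontfun (transfer_op (a *\<^sub>R u)) x = apply_bcontfun (a *\<^sub>R transfer_op u) x"
      by (simp add: apply_transfer_op transfer_def per_cmult[OF d])
  qed
  show "norm (transfer_op u) \<le> norm u * (10 * decay_sum * (c\<^sup>2 / \<beta> + \<beta>))" for u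
  proof (rule norm_bound)
    fix x
    have "\<bar>transfer (apply_bcontfun u) x\<bar> \<le> 10 * decay_sum * (norm u * (c\<^sup>2 / \<beta> + \<beta>))"
      by (rule transfer_bound(2)[OF continuous_on_apply_bcontfun abs_apply_bcontfun_le])
    then show "norm (apply_bcontfun (transfer_op u) x) \<le> norm u * (10 * decay_sum * (c\<^sup>2 / \<beta> + \<beta>))"
      by (simp add: apply_transfer_op mult_ac)
  qed
qed

lemma periodic_var_mono: "periodic_var u a w \<Longrightarrow> a \<le> a' \<Longrightarrow> w \<le> w' \<Longrightarrow> periodic_var u a' w'"
  unfolding periodic_var_def by force

text \<open>Iteration is possible because the first application already yields a periodic function.
  With D = \<open>distortion\<close> and q = \<open>ratio\<close>, the coefficient D / (1 - q) is
  the fixed point of s = q s + D, so it does not grow with n.\<close>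

lemma transfer_iterate_var:
  assumes "local_var u a w"
  shows "periodic_var ((transfer ^^ Suc n) u) a (ratio ^ Suc n * w + distortion / (1 - ratio) * a)"
proof (induction n)
  have a: "0 \<le> a"
  proof -
    obtain u' where "C1 u u'" "integral {-2..2} (\<lambda>x. \<bar>u x\<bar>) \<le> 2 * a"
      using assms unfolding local_var_def by blast
    moreover have "0 \<le> integral {-2..2} (\<lambda>x. \<bar>u x\<bar>)"
      by (intro integral_nonneg integrable_continuous_real continuous_intros C1D[OF \<open>C1 u u'\<close>]) auto
    ultimately show ?thesis by linarith
  qed
  case 0
  have "distortion * 1 \<le> distortion / (1 - ratio)"
    using ratio distortion(1) by (simp add: pos_le_divide_eq mult_left_le)
  then have "distortion * a \<le> distortion / (1 - ratio) * a"
    using a by (intro mult_right_mono) auto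
  then show ?case
    using periodic_var_mono[OF transfer_var[OF assms] order_refl] by simp
next
  case (Suc n)
  have "ratio * (ratio ^ Suc n * w + distortion / (1 - ratio) * a) + distortion * a
      = ratio ^ Suc (Suc n) * w + distortion / (1 - ratio) * a"
    using ratio by (simp add: divide_simps) (simp add: algebra_simps)
  then show ?case
    using transfer_var[OF periodic_imp_local_var[OF Suc]] by simp
qed

lemma chi_integral_le:
  assumes v: "continuous_on UNIV v" "\<And>x. v x \<ge> 0"
  shows "integral UNIV (\<lambda>x. chi x * v x) \<le> integral {-2..2} v"
proof -
  have "integral UNIV (\<lambda>x. chi x * v x) \<le> integral UNIV (\<lambda>x. if x \<in> {-2..2} then v x else 0)"
  proof (rule integral_le)
    show "(\<lambda>x. chi x * v x) integrable_on UNIV"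
      by (rule set_lebesgue_integral_eq_integral(1), rule compact_support_absolutely_integrable[of c])
         (use c1 in \<open>auto simp: chi_eq_0 intro!: continuous_intros C1D[OF chi_C1] v\<close>)
    show "(\<lambda>x. if x \<in> {-2..2} then v x else 0) integrable_on UNIV"
      unfolding integrable_restrict_UNIV
      by (intro integrable_continuous_real continuous_on_subset[OF v(1)]) auto
    fix x
    show "chi x * v x \<le> (if x \<in> {-2..2} then v x else 0)"
    proof (cases "x \<in> {-2..2}")
      case True
      then show ?thesis using mult_right_mono[OF chi_le_1 v(2)] by simp
    next
      case False
      then have "\<bar>x\<bar> \<ge> c" using c2 by auto
      then show ?thesis by (simp add: chi_eq_0 v(2))
    qed
  qed
  then show ?thesis by (simp only: integral_restrict_UNIV)
qed

text \<open>The interval [-2, 2] carries twice the variation of one period. This turns the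
  interpolation error 8/m into 16/m, and u and its interpolant each contribute 2w to the
  variation.\<close>

lemma interp_remainder_var:
  assumes "periodic_var u a w" "m > 0"
  shows "local_var (\<lambda>x. u x - interp m u x) (16 / real m * w) (4 * w)"
proof -
  obtain u' where u: "C1 u u'" "periodic2 u" and w: "integral {0..2} (\<lambda>x. \<bar>u' x\<bar>) \<le> w"
    using assms(1) unfolding periodic_var_def by blast
  note d = C1_diff[OF u(1) interp_C1[of m u]]
  have V: "integral {-2..2} (\<lambda>x. \<bar>u' x\<bar>) \<le> 2 * w"
    using w C1_periodic2[OF u] by (subst integral_periodic2) (auto simp: periodic2_def intro!: continuous_intros C1D[OF u(1)])
  have err: "integral {-2..2} (\<lambda>x. \<bar>u x - interp m u x\<bar>) \<le> 16 / real m * w"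
    using mult_left_mono[OF V, of "8 / real m"] interp_error[OF u(1) assms(2)] by simp
  have int: "(\<lambda>x. \<bar>u' x\<bar>) integrable_on {-2..2}" "(\<lambda>x. \<bar>interp' m u x\<bar>) integrable_on {-2..2}"
    "(\<lambda>x. \<bar>u' x - interp' m u x\<bar>) integrable_on {-2..2}"
    by (intro integrable_continuous_real continuous_intros C1D[OF u(1)] C1D[OF interp_C1])+
  have "integral {-2..2} (\<lambda>x. \<bar>u' x - interp' m u x\<bar>) \<le> integral {-2..2} (\<lambda>x. \<bar>u' x\<bar> + \<bar>interp' m u x\<bar>)"
    by (intro integral_le integrable_add int abs_triangle_ineq4)
  also have "\<dots> = integral {-2..2} (\<lambda>x. \<bar>u' x\<bar>) + integral {-2..2} (\<lambda>x. \<bar>interp' m u x\<bar>)"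
    by (intro Henstock_Kurzweil_Integration.integral_add int)
  also have "\<dots> \<le> 4 * w"
    using V interp_variation[OF u(1) assms(2)] by linarith
  finally have var: "integral {-2..2} (\<lambda>x. \<bar>u' x - interp' m u x\<bar>) \<le> 4 * w" .
  have "0 \<le> integral {-2..2} (\<lambda>x. \<bar>u x - interp m u x\<bar>)"
    by (intro integral_nonneg integrable_continuous_real continuous_intros C1D[OF d]) auto
  then have "integral {-2..2} (\<lambda>x. \<bar>u x - interp m u x\<bar>) \<le> 2 * (16 / real m * w)"
    using err by linarith
  moreover have "integral UNIV (\<lambda>x. chi x * \<bar>u x - interp m u x\<bar>) \<le> 16 / real m * w"
    by (rule order_trans[OF chi_integral_le err]) (auto intro!: continuous_intros C1D[OF d])
  moreover have "integral UNIV (\<lambda>x. chi x * \<bar>u' x - interp' m u x\<bar>) \<le> 4 * w"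
    by (rule order_trans[OF chi_integral_le var]) (auto intro!: continuous_intros C1D[OF d])
  ultimately show ?thesis
    unfolding local_var_def using d by blast
qed

text \<open>Both u y and u t lie within w of u 0, so |u y| - 2w is below |u t| throughout a period
  and can be integrated. This turns decay of the variation into decay of the supremum norm.\<close>

lemma periodic_var_sup:
  assumes "periodic_var u a w"
  shows "\<bar>u x\<bar> \<le> a + 2 * w"
proof -
  obtain u' where u: "C1 u u'" "periodic2 u" and a: "integral {0..2} (\<lambda>x. \<bar>u x\<bar>) \<le> a"
    and w: "integral {0..2} (\<lambda>x. \<bar>u' x\<bar>) \<le> w"
    using assms unfolding periodic_var_def by blast
  obtain y where y: "0 \<le> y" "y < 2" "u x = u y"
    using periodic2_reduce[of x] u(2) by metis
  have "\<bar>u y\<bar> - 2 * w \<le> \<bar>u t\<bar>" if "t \<in> {0..2}" for t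
    using C1_increment[OF u(1), of 0 t 2] C1_increment[OF u(1), of 0 y 2] that y w by auto
  then have "integral {0..2::real} (\<lambda>t. \<bar>u y\<bar> - 2 * w) \<le> integral {0..2} (\<lambda>t. \<bar>u t\<bar>)"
    by (intro integral_le integrable_continuous_real continuous_intros C1D[OF u(1)]) auto
  then have "2 * (\<bar>u y\<bar> - 2 * w) \<le> a" using a by simp
  moreover have "0 \<le> integral {0..2} (\<lambda>x. \<bar>u x\<bar>)"
    by (intro integral_nonneg integrable_continuous_real continuous_intros C1D[OF u(1)]) auto
  ultimately show ?thesis using y a by simp
qed

text \<open>First n is taken so large that the variation contracts; then m makes the integral of the
  remainder small enough to absorb the distortion term. The bound a of the input drops out, since
  the remainder is controlled by w alone.\<close>

lemma contraction_parameters: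
  obtains n m :: nat where "n > 0" "m > 0"
    "\<And>u a w. periodic_var u a w \<Longrightarrow> periodic_var ((transfer ^^ n) (\<lambda>x. u x - interp m u x)) (w / 2) (w / 2)"
proof -
  let ?D = "distortion / (1 - ratio)"
  have D: "?D \<ge> 0" using ratio distortion(1) by simp
  \<comment> \<open>The remainder has variation bound 4w, so 1/16 leaves w/4.\<close>
  obtain n where n: "ratio ^ n < 1 / 16"
    using real_arch_pow_inv[of "1 / 16" ratio] ratio by auto
  then have n': "ratio ^ Suc n \<le> 1 / 16"
    using ratio power_Suc_le_self[of ratio n] by (smt (verit) power_Suc mult_left_le_one_le zero_le_power)
  \<comment> \<open>The multiple 64 bounds the distortion term by w/4, and 32 makes 16/m at most
    1/2.\<close>
  obtain m :: nat where m: "real m > 64 * ?D + 32"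
    using reals_Archimedean2 by blast
  then have m0: "m > 0" "32 \<le> real m" "64 * ?D \<le> real m"
    using D by (auto intro: Nat.gr0I)
  have "periodic_var ((transfer ^^ Suc n) (\<lambda>x. u x - interp m u x)) (w / 2) (w / 2)"
    if pv: "periodic_var u a w" for u a w
  proof (rule periodic_var_mono[OF transfer_iterate_var[OF interp_remainder_var[OF pv m0(1)]]])
    obtain u' where "C1 u u'" "integral {0..2} (\<lambda>x. \<bar>u' x\<bar>) \<le> w"
      using pv unfolding periodic_var_def by blast
    moreover have "0 \<le> integral {0..2} (\<lambda>x. \<bar>u' x\<bar>)"
      by (intro integral_nonneg integrable_continuous_real continuous_intros C1D[OF \<open>C1 u u'\<close>]) auto
    ultimately have w: "0 \<le> w" by linarith
    have "16 / real m \<le> 1 / 2" using m0 by (simp add: field_simps)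
    then show "16 / real m * w \<le> w / 2"
      using mult_right_mono[OF _ w, of "16 / real m" "1 / 2"] by simp
    have "K * 16 / real m \<le> 1 / 4" if "64 * K \<le> real m" for K
      using that m0(1) by (simp add: pos_divide_le_eq)
    from this[OF m0(3)] have "?D * 16 / real m \<le> 1 / 4" .
    then have "?D * (16 / real m * w) \<le> 1 / 4 * w"
      using mult_right_mono[OF _ w, of "?D * 16 / real m" "1 / 4"] by simp
    moreover have "ratio ^ Suc n * (4 * w) \<le> 1 / 4 * w"
      using mult_right_mono[OF n', of "4 * w"] w by simp
    ultimately show "ratio ^ Suc n * (4 * w) + ?D * (16 / real m * w) \<le> w / 2"
      by linarith
  qed
  then show ?thesis using that m0(1) by blast
qed

lemma solve_modulo_finite_rank:
  obtains n m :: nat where "n > 0"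
    "\<And>r a w. periodic_var (apply_bcontfun r) a w \<Longrightarrow>
       \<exists>u U. u - transfer_op u = r - (\<Sum>l<Suc m. interp_coeff m l U *\<^sub>R (transfer_op ^^ n) (interp_elt m l))"
proof -
  obtain n m where nm: "n > 0" "m > 0" and
    contr: "\<And>u a w. periodic_var u a w \<Longrightarrow> periodic_var ((transfer ^^ n) (\<lambda>x. u x - interp m u x)) (w / 2) (w / 2)"
    using contraction_parameters by blast
  let ?N = "\<lambda>u. (transfer_op ^^ n) (u - interp_op m u)"
  have pow: "apply_bcontfun ((transfer_op ^^ k) u) = (transfer ^^ k) (apply_bcontfun u)" for k u
    by (induction k) (auto simp: apply_transfer_op)
  have N: "periodic_var (apply_bcontfun (?N u)) (w / 2) (w / 2)" if "periodic_var (apply_bcontfun u) a w" for u a w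
  proof -
    have "apply_bcontfun (u - interp_op m u) = (\<lambda>x. apply_bcontfun u x - interp m (apply_bcontfun u) x)"
      by (simp add: fun_eq_iff apply_interp_op)
    then show ?thesis unfolding pow using contr[OF that] by simp
  qed
  have "\<exists>u U. u - transfer_op u = r - (\<Sum>l<Suc m. interp_coeff m l U *\<^sub>R (transfer_op ^^ n) (interp_elt m l))"
    if r: "periodic_var (apply_bcontfun r) a w" for r a w
  proof -
    \<comment> \<open>A common bound for both parameters, so that both halve at each step; the
      supremum is then at most s + 2s, scaled by the same power of 1/2.\<close>
    define s where "s = max a w"
    have it: "periodic_var (apply_bcontfun ((?N ^^ k) r)) (s / 2 ^ k) (s / 2 ^ k)" for k
    proof (induction k)
      case 0
      then show ?case using periodic_var_mono[OF r] by (simp add: s_def)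
    next
      case (Suc k)
      then show ?case using N[OF Suc] by (simp add: mult.commute)
    qed
    have nr: "norm ((?N ^^ k) r) \<le> 3 * s * (1 / 2) ^ k" for k
      using periodic_var_sup[OF it[of k]] by (intro norm_bound) (simp add: power_one_over)
    have "summable (\<lambda>k. 3 * s * (1 / 2) ^ k)"
      by (intro summable_mult summable_geometric) simp
    then have "summable (\<lambda>k. (?N ^^ k) r)"
      by (rule summable_comparison_test') (rule nr)
    then obtain u U where "u - transfer_op u = r - (transfer_op ^^ n) (interp_op m U)"
      using finite_rank_defect_solution[OF bounded_linear_transfer_op bounded_linear_interp_op] by blast
    moreover have "(transfer_op ^^ n) (interp_op m U)
        = (\<Sum>l<Suc m. interp_coeff m l U *\<^sub>R (transfer_op ^^ n) (interp_elt m l))"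
      unfolding interp_op_def
      by (simp only: linear_sum[OF bounded_linear.linear[OF bounded_linear_funpow[OF bounded_linear_transfer_op]]]
          linear_scale[OF bounded_linear.linear[OF bounded_linear_funpow[OF bounded_linear_transfer_op]]])
    ultimately show ?thesis by auto
  qed
  then show ?thesis using that nm(1) by blast
qed

text \<open>The functions \<open>W\<close> are fixed before k is chosen; only the coefficients vary
  with k. Since the cutoff vanishes beyond c, the solution still shows k unchanged in the
  gap.\<close>

lemma finite_rank_periodization:
  obtains d :: nat and W :: "nat \<Rightarrow> real \<Rightarrow> real" where
    "\<forall>l. continuous_on UNIV (W l)"
    "\<forall>k k'. C1 k k' \<longrightarrow> (\<forall>x. x \<le> c \<or> sqrt \<beta> \<le> x \<longrightarrow> k x = 0 \<and> k' x = 0) \<longrightarrow>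
       (\<exists>G a. continuous_on UNIV G \<and> (\<forall>x. \<bar>x\<bar> \<ge> sqrt \<beta> \<longrightarrow> G x = 0) \<and> (\<forall>x\<ge>c. G x = k x) \<and>
         (\<forall>x. per G x + per (inv_push \<beta> G) x = (\<Sum>l<d. a l * W l x)))"
proof -
  obtain n m where n: "n > 0" and
    sol: "\<And>r a w. periodic_var (apply_bcontfun r) a w \<Longrightarrow>
       \<exists>u U. u - transfer_op u = r - (\<Sum>l<Suc m. interp_coeff m l U *\<^sub>R (transfer_op ^^ n) (interp_elt m l))"
    using solve_modulo_finite_rank by blast
  let ?b = "sqrt \<beta>"
  have cb: "c < ?b" using c_sq by (rule real_less_rsqrt)
  \<comment> \<open>k reaches beyond the cutoff radius c, so its image needs the larger
    radius.\<close>
  interpret S: support_bound \<beta> ?b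
    by unfold_locales (use \<beta>_pos in auto)
  have tper: "periodic2 (transfer (apply_bcontfun u))" for u
    using per_periodic2[OF cutoff_mult(4)[OF continuous_on_apply_bcontfun abs_apply_bcontfun_le], of u]
    by (simp add: periodic2_def transfer_def)
  define W where "W l = (\<lambda>x. - apply_bcontfun ((transfer_op ^^ n) (interp_elt m l)) x)" for l
  \<comment> \<open>Here n > 0 matters: a step itself is not periodic, but every value of the
    transfer operator is.\<close>
  have Wper: "periodic2 (W l)" for l
    using n tper[of "(transfer_op ^^ (n - 1)) (interp_elt m l)"]
    by (cases n) (auto simp: W_def periodic2_def apply_transfer_op)
  have "\<exists>G a. continuous_on UNIV G \<and> (\<forall>x. \<bar>x\<bar> \<ge> ?b \<longrightarrow> G x = 0) \<and> (\<forall>x\<ge>c. G x = k x) \<and>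
         (\<forall>x. per G x + per (inv_push \<beta> G) x = (\<Sum>l<Suc m. a l * W l x))"
    if k: "C1 k k'" and k0: "\<And>x. x \<le> c \<or> ?b \<le> x \<Longrightarrow> k x = 0 \<and> k' x = 0" for k k'
  proof -
    have ks: "k x = 0" "k' x = 0" if "\<bar>x\<bar> \<ge> ?b" for x
      using k0[of x] that c1 by linarith+
    obtain B where B: "\<And>x. \<bar>k x\<bar> \<le> B" using compact_support_bounded[OF ks(1) C1D(2)[OF k]] by blast
    obtain B' where B': "\<And>x. \<bar>k' x\<bar> \<le> B'" using compact_support_bounded[OF ks(2) C1D(3)[OF k]] by blast
    let ?g = "\<lambda>x. (2 * x * k x + x\<^sup>2 * k' x) / \<beta>"
    have g0: "?g x = 0" if "\<bar>x\<bar> \<ge> ?b" for x using ks[OF that] by simp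
    have gc: "continuous_on UNIV ?g"
      by (intro continuous_intros C1D[OF k]) (use \<beta>_pos in auto)
    obtain D where D: "\<And>x. \<bar>?g x\<bar> \<le> D" using compact_support_bounded[OF g0 gc] by blast
    have b0: "0 \<le> ?b" using \<beta>_pos by simp
    note dk = compact_support_decays[OF ks(1) B b0] and dk' = compact_support_decays[OF ks(2) B' b0]
      and dJ = S.inv_push_decays[OF ks(1) B] and dJ' = S.inv_push_decays[OF g0 D]
    have dJm: "decays (\<lambda>x. - inv_push \<beta> ?g x) (D * (?b\<^sup>2 / \<beta> + \<beta>))"
      using dJ' by (simp add: decays_def)
    note dH = decays_add[OF dk dJ]
    define r where "r = (\<lambda>x. - per k x - per (inv_push \<beta> k) x)"
    have r_eq: "r x = - per (\<lambda>x. k x + inv_push \<beta> k x) x" for x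
      by (simp add: r_def per_add[OF dk dJ])
    have "C1 (per k) (per k')"
      using per_deriv[OF dk dk' C1D(1)[OF k]] per_continuous[OF dk' C1D(3)[OF k]] by (simp add: C1_def)
    moreover have "C1 (per (inv_push \<beta> k)) (per (\<lambda>x. - inv_push \<beta> ?g x))"
      unfolding C1_def
      using per_deriv[OF dJ dJm S.inv_push_deriv[OF ks C1D(1)[OF k]]]
      by (auto intro!: per_continuous[OF dJm] continuous_intros S.inv_push_continuous[OF g0 gc])
    ultimately have rC: "C1 r (\<lambda>x. - per k' x - per (\<lambda>x. - inv_push \<beta> ?g x) x)"
      unfolding r_def by (intro C1_diff C1_minus)
    have "r \<in> bcontfun"
      by (rule bcontfun_normI[OF C1D(2)[OF rC]])
         (use per_bound[OF dH] in \<open>simp add: r_eq\<close>)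
    then have rb: "apply_bcontfun (Bcontfun r) = r" by (rule Bcontfun_inverse)
    have rper: "periodic2 r"
      using per_periodic2[OF dH] by (simp add: periodic2_def r_eq)
    have "periodic_var (apply_bcontfun (Bcontfun r)) (integral {0..2} (\<lambda>x. \<bar>r x\<bar>))
        (integral {0..2} (\<lambda>x. \<bar>- per k' x - per (\<lambda>x. - inv_push \<beta> ?g x) x\<bar>))"
      unfolding periodic_var_def rb using rC rper by blast
    then obtain u U where "u - transfer_op u
        = Bcontfun r - (\<Sum>l<Suc m. interp_coeff m l U *\<^sub>R (transfer_op ^^ n) (interp_elt m l))"
      using sol by blast
    then have "apply_bcontfun (u - transfer_op u) x = apply_bcontfun
      (Bcontfun r - (\<Sum>l<Suc m. interp_coeff m l U *\<^sub>R (transfer_op ^^ n) (interp_elt m l))) x" for x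
      by simp
    then have "apply_bcontfun u x - transfer (apply_bcontfun u) x = r x + (\<Sum>l<Suc m. interp_coeff m l U * W l x)" for x
      by (simp add: apply_bcontfun_sum rb apply_transfer_op W_def sum_negf del: sum.lessThan_Suc)
    then have u_eq: "apply_bcontfun u x = transfer (apply_bcontfun u) x + r x + (\<Sum>l<Suc m. interp_coeff m l U * W l x)" for x
      by (simp add: algebra_simps del: sum.lessThan_Suc)
    \<comment> \<open>So far u is only bounded and continuous; it inherits periodicity from the
      right-hand side of its equation.\<close>
    have uper: "periodic2 (apply_bcontfun u)"
      unfolding periodic2_def
    proof
      fix x
      show "apply_bcontfun u (x + 2) = apply_bcontfun u x"
        unfolding u_eq[of "x + 2"] u_eq[of x]
        using tper[of u] rper Wper by (simp add: periodic2_def)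
    qed
    define G where "G = (\<lambda>x. chi x * apply_bcontfun u x + k x)"
    note f = cutoff_mult[OF continuous_on_apply_bcontfun abs_apply_bcontfun_le]
    note fu = per_cutoff[OF uper abs_apply_bcontfun_le]
    have G1: "continuous_on UNIV G"
      unfolding G_def by (intro continuous_intros f(2) C1D[OF k])
    have G2: "G x = 0" if "\<bar>x\<bar> \<ge> ?b" for x
      using that cb ks chi_eq_0[of x] by (simp add: G_def)
    have G3: "G x = k x" if "x \<ge> c" for x
      using that c1 chi_eq_0[of x] by (simp add: G_def)
    have G4: "per G x + per (inv_push \<beta> G) x = (\<Sum>l<Suc m. interp_coeff m l U * W l x)" for x
    proof -
      have "inv_push \<beta> G = (\<lambda>x. inv_push \<beta> (\<lambda>x. chi x * apply_bcontfun u x) x + inv_push \<beta> k x)"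
        by (simp add: inv_push_def fun_eq_iff G_def distrib_right add_divide_distrib)
      then have "per (inv_push \<beta> G) x = - transfer (apply_bcontfun u) x + per (inv_push \<beta> k) x"
        using per_add[OF f(4) dJ] by (simp add: transfer_def)
      moreover have "per G x = apply_bcontfun u x + per k x"
        unfolding G_def using per_add[OF fu(2) dk] fu(1) by simp
      ultimately show ?thesis
        using u_eq[of x] by (simp add: r_def del: sum.lessThan_Suc)
    qed
    show ?thesis
      by (intro exI[of _ G] exI[of _ "\<lambda>l. interp_coeff m l U"] conjI allI impI G1 G2 G3 G4)
  qed
  moreover have "continuous_on UNIV (W l)" for l
    unfolding W_def by (intro continuous_intros continuous_on_apply_bcontfun)
  ultimately show ?thesis using that[of W "Suc m"] by blast
qed

end

section \<open>Annihilators and codimension\<close>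

text \<open>Gaussian elimination: a pivot row p clears column d from the other rows, the induction
  hypothesis solves the remaining columns, and the coefficient of p is then determined by column
  d.\<close>

lemma underdetermined_system:
  fixes v :: "nat \<Rightarrow> nat \<Rightarrow> 'a::field"
  assumes "finite I" "card I > d"
  shows "\<exists>a. (\<exists>i\<in>I. a i \<noteq> 0) \<and> (\<forall>l<d. (\<Sum>i\<in>I. a i * v i l) = 0)"
  using assms
proof (induction d arbitrary: I v)
  case 0
  then obtain i where "i \<in> I" by fastforce
  then show ?case by (intro exI[of _ "\<lambda>_. 1"]) auto
next
  case (Suc d)
  show ?case
  proof (cases "\<forall>i\<in>I. v i d = 0")
    case True
    obtain a where a: "\<exists>i\<in>I. a i \<noteq> 0" "\<forall>l<d. (\<Sum>i\<in>I. a i * v i l) = 0"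
      using Suc.IH[of I v] Suc.prems by auto
    then have "\<forall>l<Suc d. (\<Sum>i\<in>I. a i * v i l) = 0"
      using True by (auto simp: less_Suc_eq)
    then show ?thesis using a(1) by blast
  next
    case False
    then obtain p where p: "p \<in> I" "v p d \<noteq> 0" by blast
    let ?J = "I - {p}"
    let ?v = "\<lambda>i l. v i l - v i d / v p d * v p l"
    have "finite ?J" "card ?J > d" using Suc.prems p by auto
    then obtain a where a: "\<exists>i\<in>?J. a i \<noteq> 0" "\<And>l. l < d \<Longrightarrow> (\<Sum>i\<in>?J. a i * ?v i l) = 0"
      using Suc.IH[of ?J ?v] by blast
    define s where "s = (\<Sum>i\<in>?J. a i * v i d) / v p d"
    let ?a = "a(p := - s)"
    have split: "(\<Sum>i\<in>I. ?a i * v i l) = (\<Sum>i\<in>?J. a i * v i l) - s * v p l" for l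
    proof -
      have "(\<Sum>i\<in>I. ?a i * v i l) = ?a p * v p l + (\<Sum>i\<in>?J. ?a i * v i l)"
        by (rule sum.remove[OF Suc.prems(1) p(1)])
      also have "(\<Sum>i\<in>?J. ?a i * v i l) = (\<Sum>i\<in>?J. a i * v i l)"
        by (intro sum.cong) auto
      finally show ?thesis by simp
    qed
    have "(\<Sum>i\<in>?J. a i * v i l) - s * v p l = (\<Sum>i\<in>?J. a i * ?v i l)" for l
      by (simp add: s_def sum_divide_distrib sum_distrib_right right_diff_distrib sum_subtractf mult.assoc)
    then have "(\<Sum>i\<in>I. ?a i * v i l) = 0" if "l < d" for l
      using a(2)[OF that] split by simp
    moreover have "(\<Sum>i\<in>I. ?a i * v i d) = 0"
    proof -
      have "(\<Sum>i\<in>I. ?a i * v i d) = (\<Sum>i\<in>?J. a i * v i d) - s * v p d" by (rule split)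
      also have "\<dots> = 0" using p by (simp add: s_def)
      finally show ?thesis .
    qed
    ultimately have "\<forall>l<Suc d. (\<Sum>i\<in>I. ?a i * v i l) = 0"
      by (auto simp: less_Suc_eq)
    moreover have "\<exists>i\<in>I. ?a i \<noteq> 0" using a(1) by auto
    ultimately show ?thesis by blast
  qed
qed

lemma absolutely_integrable_UNIV_lebesgue:
  fixes f :: "real \<Rightarrow> real"
  assumes "f absolutely_integrable_on UNIV"
  shows "integrable lebesgue f" "integral\<^sup>L lebesgue f = integral UNIV f"
  using assms set_lebesgue_integral_eq_integral(2)[OF assms]
  by (simp_all add: set_integrable_def set_lebesgue_integral_def)

lemma ess_bounded_integrable_mult:
  assumes "ess_bounded f" "integrable lebesgue g"
  shows "integrable lebesgue (\<lambda>x. f x * g x)"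
proof -
  obtain C where C: "AE x in lebesgue. norm (f x) \<le> C" and f: "f \<in> borel_measurable lebesgue"
    using assms(1) unfolding ess_bounded_def by blast
  have "integrable lebesgue (\<lambda>x. C * norm (g x))"
    using assms(2) by simp
  then show ?thesis
  proof (rule Bochner_Integration.integrable_bound)
    show "(\<lambda>x. f x * g x) \<in> borel_measurable lebesgue"
      using f assms(2) by measurable
    show "AE x in lebesgue. norm (f x * g x) \<le> norm (C * norm (g x))"
      using C
    proof eventually_elim
      case (elim x)
      then have "norm (f x) * norm (g x) \<le> C * norm (g x)"
        by (rule mult_right_mono) simp
      then show ?case by (simp add: norm_mult)
    qed
  qed
qed

lemma linf_pairing_sum_right:
  assumes "\<And>i. i \<in> I \<Longrightarrow> integrable lebesgue (g i)"
  shows "linf_pairing \<phi> (\<lambda>x. \<Sum>i\<in>I. a i * g i x) = (\<Sum>i\<in>I. a i * linf_pairing \<phi> (g i))"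
  using assms
proof (transfer fixing: I a g)
  fix \<phi> assume "linf_rel \<phi> \<phi>" and g: "\<And>i. i \<in> I \<Longrightarrow> integrable lebesgue (g i)"
  then have \<phi>: "ess_bounded \<phi>" by (simp add: linf_rel_def)
  have "(LINT x|lebesgue. \<phi> x * (\<Sum>i\<in>I. a i * g i x)) = (LINT x|lebesgue. (\<Sum>i\<in>I. a i * (\<phi> x * g i x)))"
    by (simp add: sum_distrib_left mult_ac)
  also have "\<dots> = (\<Sum>i\<in>I. a i * (LINT x|lebesgue. \<phi> x * g i x))"
    by (subst Bochner_Integration.integral_sum) (auto intro!: ess_bounded_integrable_mult[OF \<phi> g])
  finally show "(LINT x|lebesgue. \<phi> x * (\<Sum>i\<in>I. a i * g i x)) = (\<Sum>i\<in>I. a i * (LINT x|lebesgue. \<phi> x * g i x))" .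
qed

lemma subspace_annihilator:
  assumes g: "integrable lebesgue g"
  shows "linf.subspace {\<phi>. linf_pairing \<phi> g = 0}"
proof -
  have "linf_pairing 0 g = 0" by transfer simp
  moreover have "linf_pairing (\<phi> + \<psi>) g = linf_pairing \<phi> g + linf_pairing \<psi> g" for \<phi> \<psi>
  proof (transfer fixing: g)
    fix \<phi> \<psi> assume "linf_rel \<phi> \<phi>" "linf_rel \<psi> \<psi>"
    then show "(LINT x|lebesgue. (\<phi> x + \<psi> x) * g x) = (LINT x|lebesgue. \<phi> x * g x) + (LINT x|lebesgue. \<psi> x * g x)"
      using ess_bounded_integrable_mult[OF _ g] by (simp add: linf_rel_def distrib_right)
  qed
  moreover have "linf_pairing (scale_linf c \<phi>) g = c * linf_pairing \<phi> g" for c \<phi>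
    by transfer (simp add: mult.assoc)
  ultimately show ?thesis
    unfolding linf.subspace_def by simp
qed

lemma closedin_annihilator:
  assumes g: "integrable lebesgue g"
  shows "closedin weak_star {\<phi>. linf_pairing \<phi> g = 0}"
proof -
  have "openin weak_star {\<phi>. linf_pairing \<phi> g \<in> - {0}}"
    unfolding weak_star_def
    by (rule topology_generated_by_Basis) (use g in \<open>auto intro!: exI[of _ g] exI[of _ "- {0}"]\<close>)
  moreover have "UNIV - {\<phi>. linf_pairing \<phi> g = 0} = {\<phi>. linf_pairing \<phi> g \<in> - {0}}"
    by auto
  ultimately show ?thesis
    by (simp add: closedin_def)
qed

text \<open>The kernel of the pairing with g is a weak-star closed subspace. Containing S and B, it
  contains the closure of the span of S together with B, yet it is not the whole space.\<close>

lemma infinite_codimensionI: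
  assumes "\<And>B. finite B \<Longrightarrow> \<exists>g \<phi>. integrable lebesgue g \<and> (\<forall>\<psi>\<in>S \<union> B. linf_pairing \<psi> g = 0) \<and> linf_pairing \<phi> g \<noteq> 0"
  shows "linf.infinite_codimension (weak_star closure_of linf.span S)"
  unfolding linf.infinite_codimension_def
proof
  assume "\<exists>B. finite B \<and> linf.span (weak_star closure_of linf.span S \<union> B) = UNIV"
  then obtain B where B: "finite B" "linf.span (weak_star closure_of linf.span S \<union> B) = UNIV"
    by blast
  obtain g \<phi> where g: "integrable lebesgue g" and S: "\<And>\<psi>. \<psi> \<in> S \<union> B \<Longrightarrow> linf_pairing \<psi> g = 0"
    and \<phi>: "linf_pairing \<phi> g \<noteq> 0"
    using assms[OF B(1)] by blast
  let ?K = "{\<phi>. linf_pairing \<phi> g = 0}"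
  have "linf.span S \<subseteq> ?K"
    using S by (intro linf.span_minimal subspace_annihilator[OF g]) auto
  then have "weak_star closure_of linf.span S \<subseteq> ?K"
    by (rule closure_of_minimal[OF _ closedin_annihilator[OF g]])
  then have "linf.span (weak_star closure_of linf.span S \<union> B) \<subseteq> ?K"
    using S by (intro linf.span_minimal subspace_annihilator[OF g]) auto
  then show False using B(2) \<phi> by auto
qed

section \<open>Bump functions for the gap\<close>

definition bump :: "real \<Rightarrow> real \<Rightarrow> real \<Rightarrow> real" where
  "bump p q x = (max 0 (x - p))\<^sup>2 * (max 0 (q - x))\<^sup>2"

definition bump' :: "real \<Rightarrow> real \<Rightarrow> real \<Rightarrow> real" where
  "bump' p q x = 2 * max 0 (x - p) * (max 0 (q - x))\<^sup>2 - 2 * max 0 (q - x) * (max 0 (x - p))\<^sup>2"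

lemma bump_C1: "C1 (bump p q) (bump' p q)"
  unfolding C1_def
proof (intro conjI allI)
  fix x
  have "((\<lambda>x. x - p) has_real_derivative 1) (at x)" "((\<lambda>x. q - x) has_real_derivative - 1) (at x)"
    by (auto intro!: derivative_eq_intros)
  note d = this[THEN DERIV_chain2[OF DERIV_max0_power2]]
  show "(bump p q has_real_derivative bump' p q x) (at x)"
    unfolding bump_def [abs_def] bump'_def
    by (rule DERIV_cong[OF DERIV_mult[OF d]]) simp
  show "continuous_on UNIV (bump' p q)"
    unfolding bump'_def [abs_def] by (intro continuous_intros)
qed

lemma bump_eq_0: "x \<le> p \<or> q \<le> x \<Longrightarrow> bump p q x = 0 \<and> bump' p q x = 0"
  by (auto simp: bump_def bump'_def)

lemma bump_integral_pos:
  assumes "p < q"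
  shows "integral UNIV (bump p q) > 0"
proof -
  have cont: "continuous_on {p..q} (bump p q)" by (rule C1D[OF bump_C1])
  have nn: "0 \<le> bump p q x" for x by (simp add: bump_def)
  have eq: "integral UNIV (bump p q) = integral {p..q} (bump p q)"
    unfolding integral_restrict_UNIV[symmetric, of "{p..q}"]
    by (rule arg_cong[of _ _ "integral UNIV"]) (use bump_eq_0[of _ p q] in \<open>auto simp: fun_eq_iff\<close>)
  have "integral {p..q} (bump p q) \<ge> 0"
    by (intro integral_nonneg integrable_continuous_real cont nn)
  moreover have "integral {p..q} (bump p q) \<noteq> 0"
  proof
    assume "integral {p..q} (bump p q) = 0"
    then have "\<forall>x\<in>{p..q}. bump p q x = 0"
      using integral_eq_0_iff[OF cont assms] by (simp only: nn)
    then have "bump p q ((p + q) / 2) = 0"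
      using assms by simp
    then show False using assms by (auto simp: bump_def max_def split: if_splits)
  qed
  ultimately show ?thesis unfolding eq by linarith
qed

context lattice_cross
begin

text \<open>As g is invariant under \<open>inv_push\<close> away from 0, integrating against
  \<psi>(\<beta>/x) is the same as integrating against \<psi>, and unfolding brings in the
  periodization of g. The same d coefficients therefore govern both families of
  exponentials.\<close>

lemma inversion_symmetric_integrals:
  fixes W :: "nat \<Rightarrow> real \<Rightarrow> real"
  assumes g_def: "g = (\<lambda>x. G x + inv_push \<beta> G x)"
    and G_cont: "continuous_on UNIV G" and G_supp: "\<forall>x. \<bar>x\<bar> \<ge> sqrt \<beta> \<longrightarrow> G x = 0"
    and W: "\<And>l. continuous_on UNIV (W l)"
    and eq: "\<And>x. per G x + per (inv_push \<beta> G) x = (\<Sum>l<d. a l * W l x)"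
    and \<psi>: "continuous_on UNIV \<psi>" "periodic2 \<psi>" "\<And>x. \<bar>\<psi> x\<bar> \<le> 1"
  shows "(\<lambda>x. g x * \<psi> x) absolutely_integrable_on UNIV"
    and "integral UNIV (\<lambda>x. g x * \<psi> x) = (\<Sum>l<d. a l * integral {0..2} (\<lambda>x. W l x * \<psi> x))"
    and "(\<lambda>x. g x * \<psi> (\<beta> / x)) absolutely_integrable_on UNIV"
    and "integral UNIV (\<lambda>x. g x * \<psi> (\<beta> / x)) = (\<Sum>l<d. a l * integral {0..2} (\<lambda>x. W l x * \<psi> x))"
proof -
  note G = G_cont G_supp[rule_format]
  interpret S: support_bound \<beta> "sqrt \<beta>"
    by unfold_locales (use \<beta>_pos in auto)
  obtain B where B: "\<And>x. \<bar>G x\<bar> \<le> B"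
    using compact_support_bounded[OF G(2,1)] by blast
  have dG: "decays G (B * (1 + (sqrt \<beta>)\<^sup>2))"
    by (rule compact_support_decays[OF G(2) B S.c_pos[THEN less_imp_le]])
  have dJ: "decays (inv_push \<beta> G) (B * ((sqrt \<beta>)\<^sup>2 / \<beta> + \<beta>))"
    by (rule S.inv_push_decays[OF G(2) B])
  obtain K where dg: "decays g K"
    using decays_add[OF dG dJ] unfolding g_def by blast
  have gc: "continuous_on UNIV g"
    unfolding g_def by (intro continuous_intros G(1) S.inv_push_continuous[OF G(2,1)])
  have dg\<psi>: "decays (\<lambda>x. g x * \<psi> x) K"
    using decays_mult_bounded[OF dg \<psi>(3)] by simp
  have g\<psi>c: "continuous_on UNIV (\<lambda>x. g x * \<psi> x)"
    by (intro continuous_intros gc \<psi>)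
  show g\<psi>: "(\<lambda>x. g x * \<psi> x) absolutely_integrable_on UNIV"
    by (rule decays_absolutely_integrable[OF dg\<psi> g\<psi>c])
  have "integral UNIV (\<lambda>x. g x * \<psi> x) = integral {0..2} (per (\<lambda>x. g x * \<psi> x))"
    by (rule per_integral[symmetric, OF dg\<psi> g\<psi>c])
  also have "per (\<lambda>x. g x * \<psi> x) = (\<lambda>x. \<Sum>l<d. a l * (W l x * \<psi> x))"
    unfolding per_mult_periodic2[OF \<psi>(2) dg] fun_eq_iff
    unfolding g_def by (simp add: per_add[OF dG dJ] eq sum_distrib_right mult.assoc per_mult_periodic2[OF \<psi>(2) dg, unfolded g_def])
  also have "integral {0..2} \<dots> = (\<Sum>l<d. a l * integral {0..2} (\<lambda>x. W l x * \<psi> x))"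
  proof (subst Henstock_Kurzweil_Integration.integral_sum)
    show "(\<lambda>x. a l * (W l x * \<psi> x)) integrable_on {0..2}" for l
      by (intro integrable_continuous_real continuous_intros continuous_on_subset[OF W] continuous_on_subset[OF \<psi>(1)]) auto
  qed auto
  finally show int: "integral UNIV (\<lambda>x. g x * \<psi> x) = (\<Sum>l<d. a l * integral {0..2} (\<lambda>x. W l x * \<psi> x))" .
  \<comment> \<open>Applying the inversion twice gives back G away from 0, so the two summands of g
    are interchanged.\<close>
  have push: "inv_push \<beta> (\<lambda>x. g x * \<psi> x) y = g y * \<psi> (\<beta> / y)" if "y \<noteq> 0" for y
    using that \<beta>_pos by (simp add: inv_push_def g_def field_simps power2_eq_square)
  have neg: "negligible {0::real}" by simp
  show "(\<lambda>x. g x * \<psi> (\<beta> / x)) absolutely_integrable_on UNIV"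
    by (rule absolutely_integrable_spike[OF inv_push_integral(1)[OF \<beta>_pos g\<psi>] neg]) (simp add: push)
  have "integral UNIV (\<lambda>x. g x * \<psi> (\<beta> / x)) = integral UNIV (inv_push \<beta> (\<lambda>x. g x * \<psi> x))"
    by (rule integral_spike[OF neg]) (simp add: push)
  then show "integral UNIV (\<lambda>x. g x * \<psi> (\<beta> / x)) = (\<Sum>l<d. a l * integral {0..2} (\<lambda>x. W l x * \<psi> x))"
    by (simp add: inv_push_integral(2)[OF \<beta>_pos g\<psi>] int)
qed

end

section \<open>Pairings with the exponentials and the conclusion\<close>

lemma lint_cis:
  fixes g t :: "real \<Rightarrow> real"
  assumes "(\<lambda>x. g x * cos (t x)) absolutely_integrable_on UNIV" "(\<lambda>x. g x * sin (t x)) absolutely_integrable_on UNIV"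
  shows "(LINT x|lebesgue. exp (\<i> * of_real (t x)) * of_real (g x))
    = of_real (integral UNIV (\<lambda>x. g x * cos (t x))) + \<i> * of_real (integral UNIV (\<lambda>x. g x * sin (t x)))"
proof -
  note c = absolutely_integrable_UNIV_lebesgue[OF assms(1)] and s = absolutely_integrable_UNIV_lebesgue[OF assms(2)]
  have "(LINT x|lebesgue. exp (\<i> * of_real (t x)) * of_real (g x))
      = (LINT x|lebesgue. of_real (g x * cos (t x)) + \<i> * complex_of_real (g x * sin (t x)))"
    by (intro Bochner_Integration.integral_cong refl) (simp add: cis_conv_exp[symmetric] complex_eq_iff)
  also have "\<dots> = (LINT x|lebesgue. complex_of_real (g x * cos (t x))) + \<i> * (LINT x|lebesgue. complex_of_real (g x * sin (t x)))"
    by (subst Bochner_Integration.integral_add)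
       (auto intro!: integrable_mult_right integrable_of_real c(1) s(1) simp del: of_real_mult)
  also have "\<dots> = of_real (integral UNIV (\<lambda>x. g x * cos (t x))) + \<i> * of_real (integral UNIV (\<lambda>x. g x * sin (t x)))"
    by (simp only: integral_complex_of_real c(2) s(2))
  finally show ?thesis .
qed

lemma periodic2_cos_sin:
  "periodic2 (\<lambda>x. cos (of_int m * pi * x))" "periodic2 (\<lambda>x. sin (of_int m * pi * x))"
proof -
  have "of_int m * pi * (x + 2) = of_int m * pi * x + 2 * pi * of_int m" for x :: real
    by (simp add: algebra_simps)
  then show "periodic2 (\<lambda>x. cos (of_int m * pi * x))" "periodic2 (\<lambda>x. sin (of_int m * pi * x))"
    by (simp_all add: periodic2_def cos_add sin_add sin_int_2pin cos_int_2pin)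
qed

theorem theorem1p3:
  fixes \<beta> :: real
  assumes "\<beta> > 0" and "\<beta> > 1"
  shows "linf.infinite_codimension (weak_star closure_of hyperbolic_span \<beta>)"
proof -
  let ?b = "sqrt \<beta>"
  \<comment> \<open>The midpoint of 1 and \<open>sqrt \<beta>\<close>, capped at 3/2 to stay below
    2.\<close>
  define c where "c = min (3 / 2) ((1 + ?b) / 2)"
  have b1: "?b > 1" using assms by simp
  have c: "1 < c" "c < 2" "c < ?b"
  proof -
    have "1 < min (3 / 2) ((1 + t) / 2) \<and> min (3 / 2) ((1 + t) / 2) < 2 \<and> min (3 / 2) ((1 + t) / 2) < t"
      if "t > 1" for t :: real
      using that by (auto simp: min_def)
    from this[OF b1] show "1 < c" "c < 2" "c < ?b" unfolding c_def by blast+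
  qed
  then have "c\<^sup>2 < ?b\<^sup>2" by (intro power_strict_mono) auto
  then interpret lattice_cross \<beta> c
    by unfold_locales (use c assms in auto)
  obtain d :: nat and W :: "nat \<Rightarrow> real \<Rightarrow> real" where W: "\<forall>l. continuous_on UNIV (W l)" and per:
    "\<forall>k k'. C1 k k' \<longrightarrow> (\<forall>x. x \<le> c \<or> ?b \<le> x \<longrightarrow> k x = 0 \<and> k' x = 0) \<longrightarrow>
       (\<exists>G a. continuous_on UNIV G \<and> (\<forall>x. \<bar>x\<bar> \<ge> ?b \<longrightarrow> G x = 0) \<and> (\<forall>x\<ge>c. G x = k x) \<and>
         (\<forall>x. per G x + per (inv_push \<beta> G) x = (\<Sum>l<d. a l * W l x)))"
    by (rule finite_rank_periodization) (rule that; assumption)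
  \<comment> \<open>The intervals [p i, q i] subdivide the gap: they start at
    \<open>q 0 = ?b\<close>, adjoin because \<open>q (i + 1) = p i\<close>, and accumulate at
    c.\<close>
  define p where "p i = c + (?b - c) / (real i + 2)" for i :: nat
  define q where "q i = c + (?b - c) / (real i + 1)" for i :: nat
  have pq: "c < p i" "p i < q i" "q i \<le> ?b" for i
  proof -
    have L: "0 < ?b - c" using c by simp
    have "(?b - c) / (real i + 1) \<le> ?b - c"
      using mult_left_mono[of 1 "real i + 1" "?b - c"] L by (simp add: pos_divide_le_eq)
    then show "q i \<le> ?b" by (simp add: q_def)
    show "c < p i" using L by (simp add: p_def)
    show "p i < q i" unfolding p_def q_def
      by (intro add_strict_left_mono divide_strict_left_mono L) auto
  qed
  have disjoint: "q j \<le> p i" if "i < j" for i j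
    using that c by (auto simp: p_def q_def intro!: divide_left_mono)
  have "\<forall>i. \<exists>G a. continuous_on UNIV G \<and> (\<forall>x. \<bar>x\<bar> \<ge> ?b \<longrightarrow> G x = 0) \<and> (\<forall>x\<ge>c. G x = bump (p i) (q i) x) \<and>
         (\<forall>x. per G x + per (inv_push \<beta> G) x = (\<Sum>l<d. a l * W l x))"
  proof
    fix i
    show "\<exists>G a. continuous_on UNIV G \<and> (\<forall>x. \<bar>x\<bar> \<ge> ?b \<longrightarrow> G x = 0) \<and> (\<forall>x\<ge>c. G x = bump (p i) (q i) x) \<and>
         (\<forall>x. per G x + per (inv_push \<beta> G) x = (\<Sum>l<d. a l * W l x))"
    proof (rule per[rule_format, OF bump_C1])
      fix x assume "x \<le> c \<or> ?b \<le> x"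
      then have "x \<le> p i \<or> q i \<le> x" using pq[of i] by linarith
      then show "bump (p i) (q i) x = 0 \<and> bump' (p i) (q i) x = 0" by (rule bump_eq_0)
    qed
  qed
  then obtain G a where G: "\<And>i. continuous_on UNIV (G i)" "\<And>i. \<forall>x. \<bar>x\<bar> \<ge> ?b \<longrightarrow> G i x = 0"
    "\<And>i x. x \<ge> c \<Longrightarrow> G i x = bump (p i) (q i) x"
    "\<And>i x. per (G i) x + per (inv_push \<beta> (G i)) x = (\<Sum>l<d. a i l * W l x)"
    by metis
  define g where "g i = (\<lambda>x. G i x + inv_push \<beta> (G i) x)" for i
  note gi = inversion_symmetric_integrals[OF g_def G(1,2) W[rule_format] G(4)]
  \<comment> \<open>For x in the gap, \<beta> / x lies at or beyond \<open>sqrt \<beta>\<close>,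
    where G vanishes; so the symmetrization adds nothing there and the bumps stay visible.\<close>
  have g_bump: "g i x = bump (p i) (q i) x" if "c \<le> x" "x \<le> ?b" for i x
  proof -
    have "?b * x \<le> ?b * ?b" using that assms by (intro mult_left_mono) auto
    then have "?b \<le> \<beta> / x" using that c assms by (simp add: pos_le_divide_eq)
    then have "?b \<le> \<bar>\<beta> / x\<bar>" by linarith
    then show ?thesis using G(2) G(3)[OF that(1), of i] by (simp add: g_def inv_push_def)
  qed
  have g_int: "integrable lebesgue (\<lambda>x. complex_of_real (g i x))" for i
    using gi(1)[of "\<lambda>x. 1" i] by (intro integrable_of_real absolutely_integrable_UNIV_lebesgue(1)) (auto simp: periodic2_def)
  define \<delta> where "\<delta> m l = complex_of_real (integral {0..2} (\<lambda>x. W l x * cos (of_int m * pi * x)))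
    + \<i> * complex_of_real (integral {0..2} (\<lambda>x. W l x * sin (of_int m * pi * x)))" for m :: int and l
  have cs: "continuous_on UNIV (\<lambda>x. cos (of_int m * pi * x))" "continuous_on UNIV (\<lambda>x. sin (of_int m * pi * x))"
    "\<bar>cos (of_int m * pi * x)\<bar> \<le> 1" "\<bar>sin (of_int m * pi * x)\<bar> \<le> 1" for m :: int and x :: real
    by (auto intro!: continuous_intros)
  note gcos = gi[OF cs(1) periodic2_cos_sin(1) cs(3)] and gsin = gi[OF cs(2) periodic2_cos_sin(2) cs(4)]
  have pair_exp: "linf_pairing (exp_linf m) (\<lambda>x. complex_of_real (g i x)) = (\<Sum>l<d. of_real (a i l) * \<delta> m l)" for m i
  proof -
    have "linf_pairing (exp_linf m) (\<lambda>x. complex_of_real (g i x))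
        = (LINT x|lebesgue. exp (\<i> * of_real (of_int m * pi * x)) * of_real (g i x))"
      by (transfer fixing: g) (simp add: mult.assoc)
    also have "\<dots> = (\<Sum>l<d. of_real (a i l) * \<delta> m l)"
      unfolding lint_cis[OF gcos(1) gsin(1)] gcos(2) gsin(2)
      by (simp add: \<delta>_def sum_distrib_left sum.distrib algebra_simps)
    finally show ?thesis .
  qed
  have pair_exp_inv: "linf_pairing (exp_inv_linf \<beta> m) (\<lambda>x. complex_of_real (g i x)) = (\<Sum>l<d. of_real (a i l) * \<delta> m l)" for m i
  proof -
    have "linf_pairing (exp_inv_linf \<beta> m) (\<lambda>x. complex_of_real (g i x))
        = (LINT x|lebesgue. exp (\<i> * of_real (of_int m * pi * (\<beta> / x))) * of_real (g i x))"
      by (transfer fixing: g \<beta>) (simp add: mult.assoc)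
    also have "\<dots> = (\<Sum>l<d. of_real (a i l) * \<delta> m l)"
      unfolding lint_cis[OF gcos(3) gsin(3)] gcos(4) gsin(4)
      by (simp add: \<delta>_def sum_distrib_left sum.distrib algebra_simps)
    finally show ?thesis .
  qed
  show ?thesis
    unfolding hyperbolic_span_def
  proof (rule infinite_codimensionI)
    fix B :: "linf set" assume "finite B"
    then obtain e where e: "bij_betw e {0..<card B} B"
      using ex_bij_betw_nat_finite by blast
    \<comment> \<open>The first d conditions remove the defect in the span of the
      \<open>W l\<close>, and hence the pairings with all exponentials; the others make the
      combination annihilate B.\<close>
    define v where "v i l = (if l < d then of_real (a i l) else linf_pairing (e (l - d)) (\<lambda>x. complex_of_real (g i x)))" for i l
    \<comment> \<open>One index more than there are conditions.\<close>
    let ?I = "{..d + card B}"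
    obtain \<alpha> where \<alpha>: "\<exists>i\<in>?I. \<alpha> i \<noteq> 0" "\<And>l. l < d + card B \<Longrightarrow> (\<Sum>i\<in>?I. \<alpha> i * v i l) = 0"
      using underdetermined_system[of ?I "d + card B" v] by auto
    define f where "f = (\<lambda>x. \<Sum>i\<in>?I. \<alpha> i * complex_of_real (g i x))"
    have pf: "linf_pairing \<phi> f = (\<Sum>i\<in>?I. \<alpha> i * linf_pairing \<phi> (\<lambda>x. complex_of_real (g i x)))" for \<phi>
      unfolding f_def by (rule linf_pairing_sum_right[OF g_int])
    have "integrable lebesgue f"
      unfolding f_def by (intro Bochner_Integration.integrable_sum integrable_mult_right g_int)
    moreover have "linf_pairing \<psi> f = 0" if gen: "\<psi> \<in> range exp_linf \<union> range (exp_inv_linf \<beta>) \<union> B" for \<psi>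
    proof (cases "\<psi> \<in> B")
      case True
      then obtain j where j: "j < card B" "\<psi> = e j"
        using e unfolding bij_betw_def by (metis atLeastLessThan_iff imageE)
      have "linf_pairing \<psi> f = (\<Sum>i\<in>?I. \<alpha> i * v i (d + j))"
        unfolding pf by (simp add: v_def j)
      then show ?thesis using \<alpha>(2)[of "d + j"] j by simp
    next
      case False
      then obtain m where "\<psi> = exp_linf m \<or> \<psi> = exp_inv_linf \<beta> m"
        using gen by blast
      then have m: "linf_pairing \<psi> (\<lambda>x. complex_of_real (g i x)) = (\<Sum>l<d. of_real (a i l) * \<delta> m l)" for i
        using pair_exp[of m i] pair_exp_inv[of m i] by metis
      have "linf_pairing \<psi> f = (\<Sum>i\<in>?I. \<Sum>l<d. \<alpha> i * v i l * \<delta> m l)"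
        unfolding pf m by (simp add: sum_distrib_left v_def mult.assoc)
      also have "\<dots> = (\<Sum>l<d. (\<Sum>i\<in>?I. \<alpha> i * v i l) * \<delta> m l)"
        unfolding sum_distrib_right by (rule sum.swap)
      also have "\<dots> = 0" using \<alpha>(2) by simp
      finally show ?thesis .
    qed
    moreover have "\<exists>\<phi>. linf_pairing \<phi> f \<noteq> 0"
    proof -
      obtain j where j: "j \<in> ?I" "\<alpha> j \<noteq> 0" using \<alpha>(1) by blast
      \<comment> \<open>The indicator isolates the j-th bump: the others vanish on this closed
        interval, including at a shared endpoint.\<close>
      define h where "h = (\<lambda>x. indicator {p j..q j} x :: complex)"
      have "ess_bounded h"
        unfolding h_def by (rule ess_bounded_bounded[where C = 1]) (auto simp: indicator_def)
      then have h: "linf_rel h h" by (simp add: linf_rel_def)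
      have hf: "h x * f x = \<alpha> j * complex_of_real (bump (p j) (q j) x)" for x
      proof (cases "x \<in> {p j..q j}")
        case True
        then have x: "c \<le> x" "x \<le> ?b" using pq[of j] by auto
        have "bump (p i) (q i) x = 0" if "i \<noteq> j" for i
          using that disjoint[of i j] disjoint[of j i] True by (intro bump_eq_0[THEN conjunct1]) (auto simp: neq_iff)
        then have "f x = (\<Sum>i\<in>{j}. \<alpha> i * complex_of_real (bump (p i) (q i) x))"
          unfolding f_def g_bump[OF x] using j by (intro sum.mono_neutral_right) auto
        then show ?thesis using True by (simp add: h_def)
      next
        case False
        then show ?thesis using bump_eq_0[of x "p j" "q j"] by (auto simp: h_def)
      qed
      have bi: "bump (p j) (q j) absolutely_integrable_on UNIV"
        using pq[of j] c assms bump_eq_0[of _ "p j" "q j"]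
        by (intro compact_support_absolutely_integrable[of ?b] C1D[OF bump_C1]) (auto simp: abs_real_def split: if_splits)
      have "linf_pairing (abs_linf h) f = (LINT x|lebesgue. h x * f x)"
        using linf_pairing.abs_eq[OF h] by simp
      also have "\<dots> = \<alpha> j * complex_of_real (integral UNIV (bump (p j) (q j)))"
        unfolding hf by (simp add: absolutely_integrable_UNIV_lebesgue(2)[OF bi])
      also have "\<dots> \<noteq> 0"
        using j bump_integral_pos[OF pq(2)[of j]] by simp
      finally show ?thesis by blast
    qed
    ultimately show "\<exists>g \<phi>. integrable lebesgue g \<and>
        (\<forall>\<psi>\<in>range exp_linf \<union> range (exp_inv_linf \<beta>) \<union> B. linf_pairing \<psi> g = 0) \<and> linf_pairing \<phi> g \<noteq> 0"
      by blast
  qed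
qed

end
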